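(* Let $\{D_\lambda\}_{\lambda\in\mathbb{N}}$ be a family of distributions over pairs $(x,y)$ of classical bit strings, and suppose there exist a (not necessarily efficient) algorithm $\mathcal{A}$ and a polynomial $p$ such that $\Pr[x\gets\mathcal{A}(y):(x,y)\gets D_\lambda]\ge\frac12+\frac1{p(\lambda)}$. Then there is no (non-interactive) commitment scheme in the correlated randomness model with $\{D_\lambda\}$ that is simultaneously statistically hiding and statistically (sum-)binding.
   Context: A (non-interactive) commitment scheme in the correlated randomness model with $\{D_\lambda\}$ consists of uniform QPT algorithms $\mathsf{Setup}$, $C$, $R$. Setup: $\mathsf{Setup}(1^\lambda)$ samples $(x,y)\gets D_\lambda$, sends $x$ to $C$ and $y$ to $R$. Commit: $C$ on input $x$ and a bit $b$ generates a quantum state $\ket{\Psi_{x,b}}$ on registers $\mathbf{C},\mathbf{R}$ and sends $\mathbf{C}$ to $R$. Reveal: $C$ sends $b$ and $\mathbf{R}$; $R$ applies a POVM $\{\Lambda_{y,b},I-\Lambda_{y,b}\}$ to $(\mathbf{C},\mathbf{R})$ and outputs $b$ on outcome $\Lambda_{y,b}$, else $\bot$. Correctness: honest runs are accepted with probability 1. Statistical hiding: every unbounded adversary given $y$ and register $\mathbf{C}$ of an honest commitment distinguishes $b=0$ from $b=1$ with advantage $\mathsf{negl}(\lambda)$. Statistical sum-binding: for any pair of unbounded malicious committers $C_0^*,C_1^*$ that receive $x$ and act identically in the commit phase, letting $p_b$ be the probability that $R$ accepts the revealed bit $b$ from $C_b^*$, $p_0+p_1\le1+\mathsf{negl}(\lambda)$.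 *)

theory Defs
  imports "Jordan_Normal_Form.Matrix" "HOL-Probability.Probability_Mass_Function"
    "HOL-Computational_Algebra.Polynomial"
begin

definition cinner :: "complex Matrix.vec \<Rightarrow> complex Matrix.vec \<Rightarrow> complex" where
  "cinner u v = (\<Sum>i<dim_vec u. cnj (u $ i) * v $ i)"

definition adj :: "complex mat \<Rightarrow> complex mat" where
  "adj M = Matrix.mat (dim_col M) (dim_row M) (\<lambda>(i, j). cnj (M $$ (j, i)))"

definition pure_state :: "nat \<Rightarrow> complex Matrix.vec \<Rightarrow> bool" where
  "pure_state n v \<longleftrightarrow> v \<in> carrier_vec n \<and> cinner v v = 1"

definition povm_elem :: "nat \<Rightarrow> complex mat \<Rightarrow> bool" where
  "povm_elem n M \<longleftrightarrow> M \<in> carrier_mat n n \<and> adj M = M \<and>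
     (\<forall>v \<in> carrier_vec n. 0 \<le> Re (cinner v (M *\<^sub>v v)) \<and> Re (cinner v (M *\<^sub>v v)) \<le> Re (cinner v v))"

definition unitary_mat :: "nat \<Rightarrow> complex mat \<Rightarrow> bool" where
  "unitary_mat n U \<longleftrightarrow> U \<in> carrier_mat n n \<and> adj U * U = 1\<^sub>m n"

definition kron :: "complex mat \<Rightarrow> complex mat \<Rightarrow> complex mat" where
  "kron A B = Matrix.mat (dim_row A * dim_row B) (dim_col A * dim_col B)
     (\<lambda>(i, j). A $$ (i div dim_row B, j div dim_col B) * B $$ (i mod dim_row B, j mod dim_col B))"

definition meas_prob :: "complex mat \<Rightarrow> complex Matrix.vec \<Rightarrow> real" where
  "meas_prob M v = Re (cinner v (M *\<^sub>v v))"

definition negl :: "(nat \<Rightarrow> real) \<Rightarrow> bool" where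
  "negl f \<longleftrightarrow> (\<forall>c::nat. \<exists>N. \<forall>n\<ge>N. \<bar>f n\<bar> \<le> 1 / real n ^ c)"

text \<open>
  Setup: D l is the distribution of (x, y) (bit strings).
  A scheme is given by register dimensions dC l, dR l of C and R, the honest
  commitment states Psi l x b on C \<otimes> R (index c * dR + r), and the receiver's
  verification POVM elements Lam l y b on C \<otimes> R.
\<close>

definition commitment_scheme ::
  "(nat \<Rightarrow> (bool list \<times> bool list) pmf) \<Rightarrow> (nat \<Rightarrow> nat) \<Rightarrow> (nat \<Rightarrow> nat) \<Rightarrow>
   (nat \<Rightarrow> bool list \<Rightarrow> bool \<Rightarrow> complex Matrix.vec) \<Rightarrow> (nat \<Rightarrow> bool list \<Rightarrow> bool \<Rightarrow> complex mat) \<Rightarrow> bool" where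
  "commitment_scheme D dC dR Psi Lam \<longleftrightarrow>
     (\<forall>l x b. pure_state (dC l * dR l) (Psi l x b)) \<and>
     (\<forall>l y b. povm_elem (dC l * dR l) (Lam l y b)) \<and>
     \<comment> \<open>correctness: honest runs accepted with probability 1\<close>
     (\<forall>l x y b. (x, y) \<in> set_pmf (D l) \<longrightarrow> meas_prob (Lam l y b) (Psi l x b) = 1)"

text \<open>Statistical hiding: any unbounded distinguisher, given y and register C
  (a binary POVM {M, I - M} on C depending on y), has negligible advantage.\<close>
definition stat_hiding ::
  "(nat \<Rightarrow> (bool list \<times> bool list) pmf) \<Rightarrow> (nat \<Rightarrow> nat) \<Rightarrow> (nat \<Rightarrow> nat) \<Rightarrow>
   (nat \<Rightarrow> bool list \<Rightarrow> bool \<Rightarrow> complex Matrix.vec) \<Rightarrow> bool" where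
  "stat_hiding D dC dR Psi \<longleftrightarrow>
     (\<forall>M :: nat \<Rightarrow> bool list \<Rightarrow> complex mat.
        (\<forall>l y. povm_elem (dC l) (M l y)) \<longrightarrow>
        negl (\<lambda>l. \<bar>measure_pmf.expectation (D l)
                     (\<lambda>(x, y). meas_prob (kron (M l y) (1\<^sub>m (dR l))) (Psi l x False))
                 - measure_pmf.expectation (D l)
                     (\<lambda>(x, y). meas_prob (kron (M l y) (1\<^sub>m (dR l))) (Psi l x True))\<bar>))"

text \<open>Statistical sum-binding. A pair of (unbounded) malicious committers that act
  identically in the commit phase is modelled (w.l.o.g., by purification) by a common
  pure state Phi l x on C \<otimes> E, where E = R \<otimes> E' has dimension dR l * dE l x,
  followed in the reveal phase by a unitary U l x b on E (committer C_b^* applies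
  U l x b, then sends b and register R). The receiver measures
  Lam l y b \<otimes> I_{E'} on C \<otimes> R \<otimes> E'.\<close>
definition accept_prob ::
  "(nat \<Rightarrow> (bool list \<times> bool list) pmf) \<Rightarrow> (nat \<Rightarrow> nat) \<Rightarrow>
   (nat \<Rightarrow> bool list \<Rightarrow> bool \<Rightarrow> complex mat) \<Rightarrow> (nat \<Rightarrow> bool list \<Rightarrow> nat) \<Rightarrow>
   (nat \<Rightarrow> bool list \<Rightarrow> complex Matrix.vec) \<Rightarrow> (nat \<Rightarrow> bool list \<Rightarrow> bool \<Rightarrow> complex mat) \<Rightarrow>
   nat \<Rightarrow> bool \<Rightarrow> real" where
  "accept_prob D dC Lam dE Phi U l b =
     measure_pmf.expectation (D l)
       (\<lambda>(x, y). meas_prob (kron (Lam l y b) (1\<^sub>m (dE l x)))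
                   (kron (1\<^sub>m (dC l)) (U l x b) *\<^sub>v Phi l x))"

definition stat_sum_binding ::
  "(nat \<Rightarrow> (bool list \<times> bool list) pmf) \<Rightarrow> (nat \<Rightarrow> nat) \<Rightarrow> (nat \<Rightarrow> nat) \<Rightarrow>
   (nat \<Rightarrow> bool list \<Rightarrow> bool \<Rightarrow> complex mat) \<Rightarrow> bool" where
  "stat_sum_binding D dC dR Lam \<longleftrightarrow>
     (\<forall>(dE :: nat \<Rightarrow> bool list \<Rightarrow> nat) (Phi :: nat \<Rightarrow> bool list \<Rightarrow> complex Matrix.vec)
       (U :: nat \<Rightarrow> bool list \<Rightarrow> bool \<Rightarrow> complex mat).
        (\<forall>l x. pure_state (dC l * (dR l * dE l x)) (Phi l x)) \<longrightarrow>
        (\<forall>l x b. unitary_mat (dR l * dE l x) (U l x b)) \<longrightarrow>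
        (\<exists>\<nu>. negl \<nu> \<and> (\<forall>l. accept_prob D dC Lam dE Phi U l False
                            + accept_prob D dC Lam dE Phi U l True \<le> 1 + \<nu> l)))"

end

theory Submission
  imports Defs "Jordan_Normal_Form.Schur_Decomposition"
begin

text \<open>
  Let \<open>\<rho>\<^sub>b\<close> be the reduced state of the honest commitment \<open>\<Psi>\<^sub>x\<^sub>,\<^sub>b\<close> on \<open>C\<close>, and
  \<open>F(x) = tr (\<rho>\<^sub>0\<^sup>1\<^sup>/\<^sup>2 \<rho>\<^sub>1\<^sup>1\<^sup>/\<^sup>2)\<close>. A committer who prepares the purification of \<open>\<rho>\<^sub>0\<close> given by its
  square root can open it to 0 with certainty and, by unitary equivalence of purifications, to 1 with
  probability at least \<open>F(x)\<^sup>2\<close>; so binding makes \<open>F(x)\<^sup>2\<close> negligible on average. By the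
  Powers--Stormer inequality some measurement \<open>M\<^sub>x\<close> of \<open>C\<close> distinguishes \<open>\<rho>\<^sub>0\<close> from \<open>\<rho>\<^sub>1\<close> with advantage at
  least \<open>1 - F(x)\<close>. A receiver who measures \<open>M\<^sub>x\<^sub>'\<close> for the guess \<open>x' \<leftarrow> A(y)\<close> gains at least \<open>1 - F(x)\<close> if
  \<open>x' = x\<close> and loses at most 1 otherwise, which is an advantage of about
  \<open>(1/2 + 1/p) - (1/2 - 1/p) = 2/p\<close> and contradicts hiding.
\<close>

text \<open>The overlap of square roots is used instead of Uhlmann's optimal one, which would call
  for a polar decomposition. The square root of a reduced state is itself the coefficient matrix of
  a purification, so one formula serves both the committer's overlap and the Powers--Stormer bound.
  Unitary equivalence of purifications amounts to equality of the Gram matrices of their rows.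
  Neither cheater knows everything: the committer sees x but not y, so each unitary must work for
  every POVM element that accepts the honest state with certainty; the receiver sees y but not x, so
  the measurements are averaged over the random guess, whose support may be infinite. Binding
  controls the average of F^2, while the receiver's advantage is linear in F. The two are matched by
  F <= \<delta>/2 + F^2/(2 \<delta>) for a free \<delta> > 0. The choice \<delta> = 1/p spends
  1/(2p) of the advantage 2/p and multiplies the binding error by p/2, which stays negligible; what
  remains is 3/(2p) up to that term.\<close>

section \<open>Inner products and Hermitian matrices\<close>

text \<open>Vectors are functions of which only the first \<open>n\<close> values count. Slices of a
  state on a tensor product, such as fixing one of the two indices, are then vectors without any
  conversion.\<close>

definition ip :: "nat \<Rightarrow> (nat \<Rightarrow> complex) \<Rightarrow> (nat \<Rightarrow> complex) \<Rightarrow> complex" where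
  "ip n u v = (\<Sum>i<n. cnj (u i) * v i)"

definition mv :: "nat \<Rightarrow> (nat \<Rightarrow> nat \<Rightarrow> complex) \<Rightarrow> (nat \<Rightarrow> complex) \<Rightarrow> nat \<Rightarrow> complex" where
  "mv n A v i = (\<Sum>j<n. A i j * v j)"

definition hermitian :: "nat \<Rightarrow> (nat \<Rightarrow> nat \<Rightarrow> complex) \<Rightarrow> bool" where
  "hermitian n A \<longleftrightarrow> (\<forall>i<n. \<forall>j<n. A i j = cnj (A j i))"

definition orthonormal :: "nat \<Rightarrow> nat \<Rightarrow> (nat \<Rightarrow> nat \<Rightarrow> complex) \<Rightarrow> bool" where
  "orthonormal n k V \<longleftrightarrow> (\<forall>a<k. \<forall>b<k. ip n (V a) (V b) = (if a = b then 1 else 0))"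

lemma cnj_ip: "cnj (ip n u v) = ip n v u"
  by (simp add: ip_def mult.commute)

lemma ip_add_right: "ip n u (\<lambda>i. v i + w i) = ip n u v + ip n u w"
  by (simp add: ip_def algebra_simps sum.distrib)

lemma ip_diff_right: "ip n u (\<lambda>i. v i - w i) = ip n u v - ip n u w"
  by (simp add: ip_def algebra_simps sum_subtractf)

lemma ip_diff_left: "ip n (\<lambda>i. v i - w i) u = ip n v u - ip n w u"
  by (simp add: ip_def algebra_simps sum_subtractf)

lemma ip_scale_right: "ip n u (\<lambda>i. c * v i) = c * ip n u v"
  by (simp add: ip_def sum_distrib_left mult.left_commute)

lemma ip_scale_left: "ip n (\<lambda>i. c * v i) u = cnj c * ip n v u"
  by (simp add: ip_def sum_distrib_left mult.assoc)

lemma ip_sum_right: "ip n u (\<lambda>i. \<Sum>a\<in>S. f a i) = (\<Sum>a\<in>S. ip n u (f a))"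
  unfolding ip_def by (subst sum.swap) (simp add: sum_distrib_left)

lemma ip_cong: "(\<And>i. i < n \<Longrightarrow> u i = u' i) \<Longrightarrow> (\<And>i. i < n \<Longrightarrow> v i = v' i) \<Longrightarrow> ip n u v = ip n u' v'"
  unfolding ip_def by (intro sum.cong) auto

lemma ip_self: "ip n v v = of_real (\<Sum>i<n. (cmod (v i))\<^sup>2)"
  unfolding ip_def of_real_sum by (intro sum.cong refl) (simp add: complex_norm_square mult.commute del: of_real_power)

lemma ip_self_Re: "ip n v v = of_real (Re (ip n v v))"
  by (simp add: ip_self)

lemma ip_self_nonneg: "0 \<le> Re (ip n v v)"
  by (simp add: ip_self sum_nonneg)

lemma ip_self_eq_0: "ip n v v = 0 \<longleftrightarrow> (\<forall>i<n. v i = 0)"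
  unfolding ip_self of_real_eq_0_iff by (subst sum_nonneg_eq_0_iff) auto

lemma mv_cong: "(\<And>j. j < n \<Longrightarrow> v j = w j) \<Longrightarrow> mv n A v i = mv n A w i"
  unfolding mv_def by (intro sum.cong) auto

lemma hermitian_swap:
  assumes "hermitian n A"
  shows "ip n (mv n A u) v = ip n u (mv n A v)"
proof -
  have "ip n (mv n A u) v = (\<Sum>i<n. \<Sum>j<n. cnj (A i j) * cnj (u j) * v i)"
    by (simp add: ip_def mv_def sum_distrib_right)
  also have "\<dots> = (\<Sum>i<n. \<Sum>j<n. cnj (u j) * (A j i * v i))"
  proof (intro sum.cong refl)
    fix i j assume "i \<in> {..<n}" "j \<in> {..<n}"
    hence "A j i = cnj (A i j)" using assms unfolding hermitian_def by blast
    thus "cnj (A i j) * cnj (u j) * v i = cnj (u j) * (A j i * v i)" by (simp only: mult_ac)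
  qed
  also have "\<dots> = (\<Sum>j<n. \<Sum>i<n. cnj (u j) * (A j i * v i))"
    by (rule sum.swap)
  also have "\<dots> = ip n u (mv n A v)"
    by (simp add: ip_def mv_def sum_distrib_left)
  finally show ?thesis .
qed

section \<open>Spectral theorem\<close>

lemma trace_similar:
  fixes A :: "complex mat"
  assumes "similar_mat_wit A B P Q" "A \<in> carrier_mat n n"
  shows "(\<Sum>i<n. A $$ (i,i)) = (\<Sum>i<n. B $$ (i,i))"
proof -
  note D = similar_mat_witD2[OF assms(2,1)]
  have tr: "(\<Sum>i<n. (X * Y) $$ (i,i)) = (\<Sum>i<n. (Y * X) $$ (i,i))"
    if "X \<in> carrier_mat n n" "Y \<in> carrier_mat n n" for X Y :: "complex mat"
  proof -
    have "(\<Sum>i<n. (X * Y) $$ (i,i)) = (\<Sum>i<n. \<Sum>j<n. X $$ (i,j) * Y $$ (j,i))"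
      using that by (simp add: scalar_prod_def atLeast0LessThan)
    also have "\<dots> = (\<Sum>i<n. \<Sum>j<n. Y $$ (i,j) * X $$ (j,i))"
      by (subst sum.swap) (simp add: mult.commute)
    also have "\<dots> = (\<Sum>i<n. (Y * X) $$ (i,i))"
      using that by (simp add: scalar_prod_def atLeast0LessThan)
    finally show ?thesis .
  qed
  have "(\<Sum>i<n. A $$ (i,i)) = (\<Sum>i<n. (P * B * Q) $$ (i,i))" using D(3) by simp
  also have "\<dots> = (\<Sum>i<n. (Q * (P * B)) $$ (i,i))" using D by (intro tr) auto
  also have "Q * (P * B) = B"
    using D by (simp flip: assoc_mult_mat)
  finally show ?thesis .
qed

text \<open>A Schur triangular form carries the eigenvalues on its diagonal and has the same trace,
  so a single eigenvalue \<open>t\<close> would force the trace to be \<open>n\<close> times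
  \<open>t\<close>.\<close>

lemma exists_eigenvalue_neq:
  fixes A :: "complex mat"
  assumes A: "A \<in> carrier_mat n n" and tr: "(\<Sum>i<n. A $$ (i,i)) \<noteq> of_nat n * t"
  shows "\<exists>e. eigenvalue A e \<and> e \<noteq> t"
proof (rule ccontr)
  assume "\<not> ?thesis"
  hence all: "\<And>e. eigenvalue A e \<Longrightarrow> e = t" by auto
  obtain es where es: "char_poly A = (\<Prod>a\<leftarrow>es. [:- a, 1:])" "length es = n"
    using char_poly_factorized[OF A] by auto
  obtain B P Q where BPQ: "schur_decomposition A es = (B, P, Q)"
    by (cases "schur_decomposition A es") auto
  note sch = schur_decomposition[OF A es(1) BPQ]
  have B: "B \<in> carrier_mat n n" using sch similar_mat_witD2[OF A] by auto
  have "e = t" if "e \<in> set es" for e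
  proof -
    have "poly (char_poly A) e = 0"
      using that unfolding es(1) poly_prod_list by (auto simp: prod_list_zero_iff)
    thus ?thesis using all eigenvalue_root_char_poly[OF A] by auto
  qed
  hence "B $$ (i,i) = t" if "i < n" for i
    using sch that B unfolding diag_mat_def by (metis (no_types, lifting) atLeastLessThan_iff bot_nat_0.extremum carrier_matD(1) image_eqI set_map set_upt)
  hence "(\<Sum>i<n. A $$ (i,i)) = of_nat n * t"
    using trace_similar[OF conjunct1[OF sch] A] by simp
  thus False using tr by simp
qed

text \<open>Rather than restricting \<open>A\<close> to the orthogonal complement of the known
  eigenvectors, the proof adds a Hermitian \<open>W\<close> that moves all their eigenvalues to one
  value \<open>t\<close>. An eigenvector of the sum for any other eigenvalue is orthogonal to every
  \<open>V a\<close>, hence is killed by \<open>W\<close> and is an eigenvector of \<open>A\<close>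
  itself.\<close>

lemma extend_eigenbasis:
  assumes A: "hermitian n A" and V: "orthonormal n k V" and kn: "k < n"
    and ev: "\<And>a i. a < k \<Longrightarrow> i < n \<Longrightarrow> mv n A (V a) i = of_real (d a) * V a i"
  shows "\<exists>u e. ip n u u = 1 \<and> (\<forall>a<k. ip n (V a) u = 0) \<and>
           (\<forall>i<n. mv n A u i = of_real e * u i)"
proof -
  define c where "c = Re (\<Sum>i<n. A i i) - (\<Sum>a<k. d a)"
  \<comment> \<open>The perturbed matrix has trace \<open>c + k * t\<close>, which equals
    \<open>n * t\<close> only for \<open>t = c / (n - k)\<close>. The summand 1 avoids this value,
    so an eigenvalue other than \<open>t\<close> exists.\<close>
  define t where "t = c / (real n - real k) + 1"
  have t: "c + real k * t \<noteq> real n * t"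
  proof
    assume "c + real k * t = real n * t"
    hence "c = (real n - real k) * t" by (simp add: algebra_simps)
    also have "\<dots> = c + (real n - real k)"
      using kn by (simp add: t_def distrib_left)
    finally show False using kn by simp
  qed
  define W where "W = (\<lambda>i j. \<Sum>a<k. of_real (t - d a) * (V a i * cnj (V a j)))"
  define B where "B = Matrix.mat n n (\<lambda>(i,j). A i j + W i j)"
  have B: "B \<in> carrier_mat n n" by (simp add: B_def)
  have "(\<Sum>i<n. W i i) = (\<Sum>a<k. of_real (t - d a) * ip n (V a) (V a))"
    unfolding W_def ip_def by (subst sum.swap) (simp add: sum_distrib_left mult.commute mult.left_commute)
  also have "\<dots> = (\<Sum>a<k. of_real (t - d a))"
    using V by (intro sum.cong) (auto simp: orthonormal_def)
  also have "\<dots> = of_real (real k * t - (\<Sum>a<k. d a))" by (simp add: sum_subtractf)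
  finally have trW: "(\<Sum>i<n. W i i) = of_real (real k * t - (\<Sum>a<k. d a))" .
  have "Re (\<Sum>i<n. B $$ (i,i)) = c + real k * t"
    using trW by (simp add: B_def sum.distrib c_def)
  hence "(\<Sum>i<n. B $$ (i,i)) \<noteq> of_nat n * of_real t"
    using t by (metis Re_complex_of_real of_real_mult of_real_of_nat_eq)
  then obtain e where e: "eigenvalue B e" "e \<noteq> of_real t"
    using exists_eigenvalue_neq[OF B] by blast
  then obtain x where x: "x \<in> carrier_vec n" "x \<noteq> 0\<^sub>v n" "B *\<^sub>v x = e \<cdot>\<^sub>v x"
    using B by (auto simp: eigenvalue_def eigenvector_def)
  define u where "u = (\<lambda>i. x $ i)"
  have u_ne: "ip n u u \<noteq> 0"
    using x(1,2) unfolding ip_self_eq_0 u_def by (auto simp: vec_eq_iff)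
  have mvW: "mv n W w i = (\<Sum>a<k. (of_real (t - d a) * ip n (V a) w) * V a i)" for w i
    unfolding mv_def W_def ip_def sum_distrib_left sum_distrib_right
    by (subst sum.swap) (simp add: mult_ac)
  have Bu: "mv n A u i + mv n W u i = e * u i" if "i < n" for i
  proof -
    have "(B *\<^sub>v x) $ i = (\<Sum>j<n. (A i j + W i j) * u j)"
      using that x(1) by (simp add: B_def scalar_prod_def u_def atLeast0LessThan)
    thus ?thesis using x that by (simp add: mv_def u_def sum.distrib algebra_simps)
  qed
  have orth: "ip n (V b) u = 0" if b: "b < k" for b
  proof -
    have "e * ip n (V b) u = ip n (V b) (\<lambda>i. mv n A u i + mv n W u i)"
      by (subst ip_scale_right[symmetric], intro ip_cong) (auto simp: Bu)
    also have "\<dots> = ip n (mv n A (V b)) u + ip n (V b) (mv n W u)"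
      by (simp add: ip_add_right hermitian_swap[OF A])
    also have "ip n (mv n A (V b)) u = of_real (d b) * ip n (V b) u"
      using ev[OF b] by (subst ip_cong[of n _ "\<lambda>i. of_real (d b) * V b i" u u]) (auto simp: ip_scale_left)
    also have "ip n (V b) (mv n W u) = (\<Sum>a<k. of_real (t - d a) * ip n (V a) u * ip n (V b) (V a))"
      unfolding mvW ip_sum_right ip_scale_right ..
    also have "\<dots> = (\<Sum>a<k. if a = b then of_real (t - d b) * ip n (V b) u else 0)"
      using V b by (intro sum.cong) (auto simp: orthonormal_def)
    also have "\<dots> = of_real (t - d b) * ip n (V b) u" using b by simp
    finally have "(e - of_real t) * ip n (V b) u = 0" by (simp add: algebra_simps)
    thus ?thesis using e by simp
  qed
  have Au: "mv n A u i = e * u i" if "i < n" for i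
    using Bu[OF that] by (simp add: mvW orth)
  have "e * ip n u u = ip n u (mv n A u)"
    by (subst ip_scale_right[symmetric], intro ip_cong) (auto simp: Au)
  also have "\<dots> = cnj (ip n u (mv n A u))" by (simp add: cnj_ip hermitian_swap[OF A])
  also have "ip n u (mv n A u) = e * ip n u u"
    by (subst ip_scale_right[symmetric], intro ip_cong) (auto simp: Au)
  finally have "e * ip n u u = cnj e * ip n u u" by (simp add: cnj_ip)
  hence "e = cnj e" using u_ne by simp
  hence ereal: "e = of_real (Re e)" by (simp add: complex_eq_iff)
  define r where "r = Re (ip n u u)"
  have r: "r > 0" "ip n u u = of_real r"
    using u_ne ip_self_nonneg[of n u] ip_self_Re[of n u] unfolding r_def
    by (auto simp: less_le)
  define w where "w = (\<lambda>i. of_real (1 / sqrt r) * u i)"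
  have "ip n w w = 1"
    using r unfolding w_def ip_scale_left ip_scale_right r(2)
    by (simp flip: of_real_mult add: field_simps)
  moreover have "\<forall>a<k. ip n (V a) w = 0" by (simp add: w_def ip_scale_right orth del: of_real_divide)
  moreover have "\<forall>i<n. mv n A w i = of_real (Re e) * w i"
  proof (intro allI impI)
    fix i assume "i < n"
    have "mv n A w i = of_real (1 / sqrt r) * mv n A u i"
      by (simp add: mv_def w_def sum_distrib_left mult_ac)
    also have "\<dots> = e * w i" by (simp add: Au[OF \<open>i < n\<close>] w_def)
    finally show "mv n A w i = of_real (Re e) * w i" using ereal by simp
  qed
  ultimately show ?thesis by blast
qed

text \<open>Orthonormality makes the adjoint a left inverse of the square matrix with columns
  \<open>V a\<close>, and for square matrices a left inverse is a right inverse.\<close>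

lemma orthonormal_complete:
  assumes V: "orthonormal n n V" and ij: "i < n" "j < n"
  shows "(\<Sum>a<n. V a i * cnj (V a j)) = (if i = j then 1 else 0)"
proof -
  define P where "P = Matrix.mat n n (\<lambda>(i,a). V a i)"
  define Q where "Q = Matrix.mat n n (\<lambda>(a,i). cnj (V a i))"
  have c: "P \<in> carrier_mat n n" "Q \<in> carrier_mat n n" by (auto simp: P_def Q_def)
  have "Q * P = 1\<^sub>m n"
    using V by (intro eq_matI) (auto simp: P_def Q_def orthonormal_def ip_def scalar_prod_def atLeast0LessThan)
  hence "P * Q = 1\<^sub>m n" using mat_mult_left_right_inverse c by blast
  moreover have "(P * Q) $$ (i,j) = (\<Sum>a<n. V a i * cnj (V a j))"
    using ij by (simp add: P_def Q_def scalar_prod_def atLeast0LessThan)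
  ultimately show ?thesis using ij by simp
qed

lemma hermitian_eigenbasis:
  assumes A: "hermitian n A"
  shows "\<exists>V d. orthonormal n n V \<and> (\<forall>a<n. \<forall>i<n. mv n A (V a) i = of_real (d a) * V a i)"
proof -
  have "\<exists>V d. orthonormal n k V \<and> (\<forall>a<k. \<forall>i<n. mv n A (V a) i = of_real (d a) * V a i)"
    if "k \<le> n" for k
    using that
  proof (induction k)
    case 0
    show ?case by (simp add: orthonormal_def)
  next
    case (Suc k)
    then obtain V d where V: "orthonormal n k V"
      and ev: "\<forall>a<k. \<forall>i<n. mv n A (V a) i = of_real (d a) * V a i" by auto
    obtain u e where u: "ip n u u = 1" "\<forall>a<k. ip n (V a) u = 0"
      "\<forall>i<n. mv n A u i = of_real e * u i"
      using extend_eigenbasis[OF A V, of d] ev Suc.prems by auto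
    have "ip n u (V a) = 0" if "a < k" for a
      using u(2) that cnj_ip[of n "V a" u] by simp
    hence "orthonormal n (Suc k) (V(k := u))"
      using V u by (auto simp: orthonormal_def less_Suc_eq)
    moreover have "\<forall>a<Suc k. \<forall>i<n. mv n A ((V(k := u)) a) i = of_real ((d(k := e)) a) * (V(k := u)) a i"
      using ev u by (auto simp: less_Suc_eq)
    ultimately show ?case by blast
  qed
  thus ?thesis by blast
qed

section \<open>Unitaries between families with equal Gram matrices\<close>

lemma mv_unit: "i < n \<Longrightarrow> mv n (\<lambda>i j. if i = j then 1 else 0) u i = u i"
  by (simp add: mv_def if_distrib[of "\<lambda>x. x * _"] cong: if_cong)

lemma mv_mult: "mv n (\<lambda>i j. \<Sum>k<n. H i k * W k j) u i = mv n H (mv n W u) i"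
proof -
  have "mv n (\<lambda>i j. \<Sum>k<n. H i k * W k j) u i = (\<Sum>j<n. \<Sum>k<n. H i k * (W k j * u j))"
    by (simp add: mv_def sum_distrib_right mult.assoc)
  also have "\<dots> = mv n H (mv n W u) i"
    by (subst sum.swap) (simp add: mv_def sum_distrib_left)
  finally show ?thesis .
qed

text \<open>The unitary is a complex Householder map \<open>u \<mapsto> u - (\<langle>d,u\<rangle> / \<langle>d,x\<rangle>) d\<close> with \<open>d = x - y\<close>.
  Division by zero being zero, it is the identity in the degenerate case \<open>\<langle>d,x\<rangle> = 0\<close>.\<close>

lemma householder:
  assumes norm: "ip m x x = ip m y y"
  shows "\<exists>H. (\<forall>u v. ip m (mv m H u) (mv m H v) = ip m u v) \<and> (\<forall>i<m. mv m H x i = y i) \<and>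
           (\<forall>u. ip m x u = ip m y u \<longrightarrow> (\<forall>i<m. mv m H u i = u i))"
proof -
  define d where "d = (\<lambda>i. x i - y i)"
  define z where "z = ip m d x"
  define H where "H = (\<lambda>i j. (if i = j then 1 else 0) - d i * cnj (d j) / z)"
  have H: "mv m H u i = u i - (ip m d u / z) * d i" if "i < m" for u i
  proof -
    have "mv m H u i = mv m (\<lambda>i j. if i = j then 1 else 0) u i - (\<Sum>j<m. d i * cnj (d j) / z * u j)"
      by (simp add: mv_def H_def left_diff_distrib sum_subtractf)
    thus ?thesis using that
      by (simp add: mv_unit ip_def sum_distrib_left sum_distrib_right sum_divide_distrib mult_ac)
  qed
  \<comment> \<open>Equal norms turn the squared norm of \<open>d\<close> into twice the real part
    of \<open>z\<close>. This is what cancels the cross terms below. Dividing by the complex number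
    \<open>z\<close> instead of half that norm lets \<open>x\<close> go to \<open>y\<close> even if
    their inner product is not real.\<close>
  have dd: "ip m d d = z + cnj z"
    using norm by (simp add: z_def d_def cnj_ip ip_diff_left ip_diff_right)
  have "ip m (mv m H u) (mv m H v) = ip m u v" for u v
  proof -
    define p q where "p = ip m d u" and "q = ip m d v"
    have ud: "ip m u d = cnj p" by (simp add: p_def cnj_ip)
    have "ip m (mv m H u) (mv m H v) = ip m (\<lambda>i. u i - (p / z) * d i) (\<lambda>i. v i - (q / z) * d i)"
      by (intro ip_cong) (auto simp: H p_def q_def)
    also have "\<dots> = ip m u v - (q / z) * cnj p - cnj (p / z) * q + cnj (p / z) * (q / z) * ip m d d"
      unfolding ip_diff_left ip_diff_right ip_scale_left ip_scale_right ud
      by (simp add: q_def algebra_simps)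
    also have "\<dots> = ip m u v"
      by (cases "z = 0") (auto simp: dd field_simps)
    finally show ?thesis .
  qed
  moreover have "mv m H x i = y i" if "i < m" for i
  proof (cases "z = 0")
    case True
    \<comment> \<open>So \<open>x\<close> and \<open>y\<close> agree, and the identity already maps
      one to the other.\<close>
    hence "ip m d d = 0" by (simp add: dd)
    thus ?thesis using that by (simp add: H True ip_self_eq_0) (simp add: d_def)
  next
    case False
    thus ?thesis using that by (simp add: H flip: z_def) (simp add: d_def)
  qed
  moreover have "mv m H u i = u i" if "ip m x u = ip m y u" "i < m" for u i
    using that by (simp add: H) (simp add: d_def ip_diff_left)
  ultimately show ?thesis by blast
qed

text \<open>One Householder map is composed per vector. The map that corrects the image of
  \<open>x n\<close> fixes each earlier \<open>y c\<close>, because the Gram equalities give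
  \<open>y c\<close> the same inner product with \<open>W (x n)\<close> as with \<open>y n\<close>.
  The families may be linearly dependent.\<close>

lemma gram_unitary:
  fixes n :: nat
  assumes "\<And>c c'. c < n \<Longrightarrow> c' < n \<Longrightarrow> ip m (x c) (x c') = ip m (y c) (y c')"
  shows "\<exists>W. (\<forall>u v. ip m (mv m W u) (mv m W v) = ip m u v) \<and> (\<forall>c<n. \<forall>i<m. mv m W (x c) i = y c i)"
  using assms
proof (induction n)
  case 0
  show ?case
    by (rule exI[of _ "\<lambda>i j. if i = j then 1 else 0"]) (auto simp: mv_unit intro!: ip_cong)
next
  case (Suc n)
  have "\<exists>W. (\<forall>u v. ip m (mv m W u) (mv m W v) = ip m u v) \<and> (\<forall>c<n. \<forall>i<m. mv m W (x c) i = y c i)"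
    by (rule Suc.IH) (simp add: Suc.prems)
  then obtain W where W: "\<And>u v. ip m (mv m W u) (mv m W v) = ip m u v"
    and Wx: "\<And>c i. c < n \<Longrightarrow> i < m \<Longrightarrow> mv m W (x c) i = y c i"
    by blast
  have "ip m (mv m W (x n)) (mv m W (x n)) = ip m (y n) (y n)"
    using W Suc.prems by simp
  from householder[OF this] obtain H where H: "\<forall>u v. ip m (mv m H u) (mv m H v) = ip m u v"
    and Hx: "\<forall>i<m. mv m H (mv m W (x n)) i = y n i"
    and Hfix: "\<forall>u. ip m (mv m W (x n)) u = ip m (y n) u \<longrightarrow> (\<forall>i<m. mv m H u i = u i)"
    by blast
  define W' where "W' = (\<lambda>i j. \<Sum>k<m. H i k * W k j)"
  have W': "mv m W' u = mv m H (mv m W u)" for u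
    by (rule ext) (simp add: W'_def mv_mult)
  have "mv m W' (x c) i = y c i" if c: "c < Suc n" and i: "i < m" for c i
  proof (cases "c = n")
    case True
    thus ?thesis using Hx i by (simp add: W')
  next
    case False
    hence c': "c < n" using c by simp
    have "mv m W' (x c) i = mv m H (y c) i"
      unfolding W' by (intro mv_cong) (simp add: Wx c')
    also have "ip m (mv m W (x n)) (y c) = ip m (mv m W (x n)) (mv m W (x c))"
      by (intro ip_cong) (auto simp: Wx c')
    hence "ip m (mv m W (x n)) (y c) = ip m (y n) (y c)"
      using W Suc.prems[of n c] c by simp
    hence "mv m H (y c) i = y c i" using Hfix i by blast
    finally show ?thesis .
  qed
  moreover have "ip m (mv m W' u) (mv m W' v) = ip m u v" for u v
    by (simp add: W' H W)
  ultimately show ?case by blast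
qed

section \<open>Functional calculus and positive square roots\<close>

text \<open>The functional calculus in the eigenbasis \<open>V\<close>: square roots and spectral
  projectors are both obtained by choosing \<open>f\<close>.\<close>

definition spectral_mat :: "nat \<Rightarrow> (nat \<Rightarrow> nat \<Rightarrow> complex) \<Rightarrow> (nat \<Rightarrow> real) \<Rightarrow> nat \<Rightarrow> nat \<Rightarrow> complex" where
  "spectral_mat n V f i j = (\<Sum>a<n. of_real (f a) * (V a i * cnj (V a j)))"

lemma hermitian_spectral_mat: "hermitian n (spectral_mat n V f)"
  by (simp add: hermitian_def spectral_mat_def mult_ac)

lemma mv_spectral_mat: "mv n (spectral_mat n V f) u i = (\<Sum>a<n. (of_real (f a) * ip n (V a) u) * V a i)"
  unfolding mv_def spectral_mat_def ip_def sum_distrib_left sum_distrib_right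
  by (subst sum.swap) (simp add: mult_ac)

lemma ip_mv_spectral_mat:
  "ip n u (mv n (spectral_mat n V f) u) = of_real (\<Sum>a<n. f a * (cmod (ip n (V a) u))\<^sup>2)"
proof -
  have "ip n u (mv n (spectral_mat n V f) u) = (\<Sum>a<n. of_real (f a) * ip n (V a) u * ip n u (V a))"
    unfolding mv_spectral_mat ip_sum_right ip_scale_right ..
  also have "\<dots> = (\<Sum>a<n. of_real (f a * (cmod (ip n (V a) u))\<^sup>2))"
    by (intro sum.cong refl)
      (simp add: complex_norm_square cnj_ip mult.assoc del: of_real_power)
  finally show ?thesis by simp
qed

lemma spectral_mat_one:
  assumes "orthonormal n n V" "i < n" "j < n"
  shows "spectral_mat n V (\<lambda>_. 1) i j = (if i = j then 1 else 0)"
  using orthonormal_complete[OF assms] by (simp add: spectral_mat_def)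

lemma parseval:
  assumes "orthonormal n n V"
  shows "(\<Sum>a<n. (cmod (ip n (V a) u))\<^sup>2) = Re (ip n u u)"
proof -
  have "mv n (spectral_mat n V (\<lambda>_. 1)) u i = mv n (\<lambda>i j. if i = j then 1 else 0) u i" if "i < n" for i
    unfolding mv_def using that by (intro sum.cong) (auto simp: spectral_mat_one[OF assms])
  hence "ip n u (mv n (spectral_mat n V (\<lambda>_. 1)) u) = ip n u u"
    by (intro ip_cong) (auto simp: mv_unit)
  thus ?thesis by (simp add: ip_mv_spectral_mat flip: of_real_power) (metis Re_complex_of_real of_real_sum)
qed

lemma spectral_mat_mult:
  assumes V: "orthonormal n n V"
  shows "(\<Sum>k<n. spectral_mat n V f i k * spectral_mat n V g k j) = spectral_mat n V (\<lambda>a. f a * g a) i j"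
proof -
  have "(\<Sum>k<n. spectral_mat n V f i k * spectral_mat n V g k j) = mv n (spectral_mat n V f) (\<lambda>k. spectral_mat n V g k j) i"
    by (simp add: mv_def)
  also have "\<dots> = (\<Sum>a<n. (of_real (f a) * (of_real (g a) * cnj (V a j))) * V a i)"
  proof (unfold mv_spectral_mat, intro sum.cong refl)
    fix a assume a: "a \<in> {..<n}"
    have "ip n (V a) (\<lambda>k. spectral_mat n V g k j) = ip n (V a) (\<lambda>k. \<Sum>b<n. (of_real (g b) * cnj (V b j)) * V b k)"
      by (simp add: spectral_mat_def mult_ac)
    also have "\<dots> = (\<Sum>b<n. of_real (g b) * cnj (V b j) * ip n (V a) (V b))"
      unfolding ip_sum_right ip_scale_right ..
    also have "\<dots> = (\<Sum>b<n. if b = a then of_real (g a) * cnj (V a j) else 0)"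
      using V a by (intro sum.cong) (auto simp: orthonormal_def)
    also have "\<dots> = of_real (g a) * cnj (V a j)" using a by simp
    finally show "of_real (f a) * ip n (V a) (\<lambda>k. spectral_mat n V g k j) * V a i
        = of_real (f a) * (of_real (g a) * cnj (V a j)) * V a i" by simp
  qed
  also have "\<dots> = spectral_mat n V (\<lambda>a. f a * g a) i j"
    by (simp add: spectral_mat_def mult_ac)
  finally show ?thesis .
qed

lemma spectral_theorem:
  assumes "hermitian n A"
  shows "\<exists>V d. orthonormal n n V \<and> (\<forall>a<n. \<forall>i<n. mv n A (V a) i = of_real (d a) * V a i) \<and>
           (\<forall>i<n. \<forall>j<n. A i j = spectral_mat n V d i j)"
proof -
  obtain V d where V: "orthonormal n n V"
    and ev: "\<And>a i. a < n \<Longrightarrow> i < n \<Longrightarrow> mv n A (V a) i = of_real (d a) * V a i"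
    using hermitian_eigenbasis[OF assms] by auto
  have "A i j = spectral_mat n V d i j" if "i < n" "j < n" for i j
  proof -
    have "spectral_mat n V d i j = (\<Sum>a<n. mv n A (V a) i * cnj (V a j))"
      using that by (simp add: spectral_mat_def ev mult.assoc)
    also have "\<dots> = (\<Sum>a<n. \<Sum>k<n. A i k * (V a k * cnj (V a j)))"
      by (simp add: mv_def sum_distrib_right mult.assoc)
    also have "\<dots> = (\<Sum>k<n. A i k * (\<Sum>a<n. V a k * cnj (V a j)))"
      by (subst sum.swap) (simp add: sum_distrib_left)
    also have "\<dots> = (\<Sum>k<n. if k = j then A i j else 0)"
      using that by (intro sum.cong) (auto simp: orthonormal_complete[OF V])
    finally show ?thesis using that by simp
  qed
  thus ?thesis using V ev by blast
qed

text \<open>The right side sees \<open>X\<close> only through the Gram matrix of its rows. This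
  allows a state to be replaced by the square root of its reduced state in measurement
  statistics.\<close>

lemma sum_ip_gram:
  "(\<Sum>r<m. of_real ((cmod (ip n u (\<lambda>i. X i r)))\<^sup>2)) =
     (\<Sum>i<n. \<Sum>j<n. cnj (u i) * u j * (\<Sum>r<m. X i r * cnj (X j r)))"
proof -
  have "of_real ((cmod (ip n u (\<lambda>i. X i r)))\<^sup>2) =
      (\<Sum>i<n. \<Sum>j<n. cnj (u i) * u j * (X i r * cnj (X j r)))" for r
    unfolding complex_norm_square cnj_ip unfolding ip_def sum_product
    by (intro sum.cong refl) (simp add: mult_ac)
  hence "(\<Sum>r<m. of_real ((cmod (ip n u (\<lambda>i. X i r)))\<^sup>2)) =
      (\<Sum>r<m. \<Sum>i<n. \<Sum>j<n. cnj (u i) * u j * (X i r * cnj (X j r)))" by simp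
  also have "\<dots> = (\<Sum>i<n. \<Sum>r<m. \<Sum>j<n. cnj (u i) * u j * (X i r * cnj (X j r)))"
    by (rule sum.swap)
  also have "\<dots> = (\<Sum>i<n. \<Sum>j<n. \<Sum>r<m. cnj (u i) * u j * (X i r * cnj (X j r)))"
    by (intro sum.cong refl, rule sum.swap)
  finally show ?thesis by (simp add: sum_distrib_left)
qed

text \<open>For the coefficient matrix \<open>X\<close> of a bipartite state, \<open>Z\<close> is
  the positive square root of the reduced state. It exists because an eigenvalue of the Gram matrix
  is a sum of squared moduli. The last clause makes the rows of \<open>Z\<close> and
  \<open>X\<close> ready for the Gram matrix criterion.\<close>

lemma psd_sqrt:
  "\<exists>Z. hermitian n Z \<and> (\<forall>u. 0 \<le> Re (ip n u (mv n Z u))) \<and>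
     (\<forall>i<n. \<forall>j<n. (\<Sum>k<n. Z i k * cnj (Z j k)) = (\<Sum>r<m. X i r * cnj (X j r)))"
proof -
  define G where "G = (\<lambda>i j. \<Sum>r<m. X i r * cnj (X j r))"
  have "hermitian n G" by (simp add: hermitian_def G_def mult.commute)
  from spectral_theorem[OF this] obtain V d where V: "orthonormal n n V"
    and ev': "\<forall>a<n. \<forall>i<n. mv n G (V a) i = of_real (d a) * V a i"
    and G': "\<forall>i<n. \<forall>j<n. G i j = spectral_mat n V d i j"
    by blast
  note ev = ev'[rule_format] and G = G'[rule_format]
  have d: "0 \<le> d a" if a: "a < n" for a
  proof -
    have "ip n (V a) (mv n G (V a)) = of_real (d a) * ip n (V a) (V a)"
      by (subst ip_scale_right[symmetric], intro ip_cong) (auto simp: ev a)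
    also have "\<dots> = of_real (d a)" using V a by (simp add: orthonormal_def)
    also have "ip n (V a) (mv n G (V a)) = (\<Sum>r<m. of_real ((cmod (ip n (V a) (\<lambda>i. X i r)))\<^sup>2))"
      unfolding sum_ip_gram by (simp add: ip_def mv_def G_def sum_distrib_left mult_ac)
    finally have "d a = (\<Sum>r<m. (cmod (ip n (V a) (\<lambda>i. X i r)))\<^sup>2)"
      unfolding of_real_sum[symmetric] of_real_eq_iff by simp
    thus ?thesis by (simp add: sum_nonneg)
  qed
  define Z where "Z = spectral_mat n V (\<lambda>a. sqrt (d a))"
  have hZ: "hermitian n Z" by (simp add: Z_def hermitian_spectral_mat)
  moreover have "0 \<le> Re (ip n u (mv n Z u))" for u
    unfolding Z_def ip_mv_spectral_mat using d by (auto intro!: sum_nonneg)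
  moreover have "(\<Sum>k<n. Z i k * cnj (Z j k)) = (\<Sum>r<m. X i r * cnj (X j r))" if "i < n" "j < n" for i j
  proof -
    have "(\<Sum>k<n. Z i k * cnj (Z j k)) = (\<Sum>k<n. Z i k * Z k j)"
    proof (intro sum.cong refl)
      fix k assume "k \<in> {..<n}"
      hence "Z k j = cnj (Z j k)" using hZ that unfolding hermitian_def by blast
      thus "Z i k * cnj (Z j k) = Z i k * Z k j" by simp
    qed
    also have "\<dots> = spectral_mat n V (\<lambda>a. sqrt (d a) * sqrt (d a)) i j"
      unfolding Z_def by (rule spectral_mat_mult[OF V])
    also have "\<dots> = spectral_mat n V d i j" unfolding spectral_mat_def using d by (intro sum.cong) auto
    also have "\<dots> = G i j" using G that by simp
    finally show ?thesis by (simp add: G_def)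
  qed
  ultimately show ?thesis by blast
qed

section \<open>Overlap of square roots against distinguishability\<close>

lemma hermitian_column_ip:
  assumes "hermitian n Z" "k < n"
  shows "ip n u (\<lambda>i. Z i k) = cnj (mv n Z u k)"
  unfolding ip_def mv_def cnj_sum
proof (intro sum.cong refl)
  fix i assume "i \<in> {..<n}"
  hence "Z i k = cnj (Z k i)" using assms unfolding hermitian_def by blast
  thus "cnj (u i) * Z i k = cnj (Z k i * u i)" by simp
qed

lemma sum_hermitian_column:
  assumes "hermitian n Z"
  shows "(\<Sum>k<n. (cmod (ip n u (\<lambda>i. Z i k)))\<^sup>2) = Re (ip n (mv n Z u) (mv n Z u))"
  using hermitian_column_ip[OF assms] by (simp add: ip_self del: of_real_sum)

text \<open>Both sides are the squared Frobenius norm of \<open>Z\<close>, evaluated in the basis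
  \<open>V\<close> and in the standard basis.\<close>

lemma parseval_hermitian:
  assumes "orthonormal n n V" "hermitian n Z"
  shows "(\<Sum>a<n. Re (ip n (mv n Z (V a)) (mv n Z (V a)))) = (\<Sum>k<n. \<Sum>i<n. (cmod (Z i k))\<^sup>2)"
  unfolding sum_hermitian_column[OF assms(2), symmetric]
  by (subst sum.swap) (simp add: parseval[OF assms(1)] ip_self del: of_real_sum)

text \<open>Meant for \<open>z0 = Z0 v\<close> and \<open>z1 = Z1 v\<close>, where \<open>v\<close>
  is a unit eigenvector of \<open>Z0 - Z1\<close> with eigenvalue \<open>s\<close>: it evaluates the
  quadratic form of the difference of the squares at \<open>v\<close>.\<close>

lemma norm_shift_along:
  assumes s: "\<And>i. i < n \<Longrightarrow> z0 i = z1 i + of_real s * v i" and vv: "ip n v v = 1"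
  shows "Re (ip n z0 z0) - Re (ip n z1 z1) = s * (2 * Re (ip n v z1) + s)"
    and "Re (ip n v z0) = Re (ip n v z1) + s"
proof -
  have "ip n v z0 = ip n v (\<lambda>i. z1 i + of_real s * v i)"
    by (intro ip_cong) (auto simp: s)
  also have "\<dots> = ip n v z1 + of_real s"
    by (simp add: ip_add_right ip_scale_right vv)
  finally have v0: "ip n v z0 = ip n v z1 + of_real s" .
  thus "Re (ip n v z0) = Re (ip n v z1) + s" by simp
  have "ip n z1 z0 = ip n z1 (\<lambda>i. z1 i + of_real s * v i)"
    by (intro ip_cong) (auto simp: s)
  also have "\<dots> = ip n z1 z1 + of_real s * cnj (ip n v z1)"
    by (simp add: ip_add_right ip_scale_right cnj_ip)
  finally have z10: "ip n z1 z0 = ip n z1 z1 + of_real s * cnj (ip n v z1)" .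
  have "ip n z0 z0 = ip n z0 (\<lambda>i. z1 i + of_real s * v i)"
    by (intro ip_cong) (auto simp: s)
  also have "\<dots> = cnj (ip n z1 z0) + of_real s * cnj (ip n v z0)"
    by (simp add: ip_add_right ip_scale_right cnj_ip)
  finally show "Re (ip n z0 z0) - Re (ip n z1 z1) = s * (2 * Re (ip n v z1) + s)"
    by (simp add: z10 v0 algebra_simps)
qed

text \<open>The argument of the Powers--Stormer inequality: the projector onto the positive part of
  \<open>Z0 - Z1\<close>, the difference of the square roots, already discriminates well enough between
  \<open>Z0\<^sup>2\<close> and \<open>Z1\<^sup>2\<close>.\<close>

lemma powers_stormer:
  assumes h0: "hermitian n Z0" and h1: "hermitian n Z1"
    and p0: "\<And>u. 0 \<le> Re (ip n u (mv n Z0 u))" and p1: "\<And>u. 0 \<le> Re (ip n u (mv n Z1 u))"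
    and n0: "(\<Sum>k<n. \<Sum>i<n. (cmod (Z0 i k))\<^sup>2) = 1" and n1: "(\<Sum>k<n. \<Sum>i<n. (cmod (Z1 i k))\<^sup>2) = 1"
  shows "\<exists>V I. orthonormal n n V \<and> I \<subseteq> {..<n} \<and>
     (\<Sum>a\<in>I. Re (ip n (mv n Z0 (V a)) (mv n Z0 (V a))) - Re (ip n (mv n Z1 (V a)) (mv n Z1 (V a))))
       \<ge> 1 - Re (\<Sum>k<n. \<Sum>i<n. cnj (Z1 i k) * Z0 i k)"
proof -
  define S where "S = (\<lambda>i j. Z0 i j - Z1 i j)"
  have hS: "hermitian n S"
    unfolding hermitian_def
  proof (intro allI impI)
    fix i j assume "i < n" "j < n"
    hence "Z0 i j = cnj (Z0 j i)" "Z1 i j = cnj (Z1 j i)"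
      using h0 h1 unfolding hermitian_def by blast+
    thus "S i j = cnj (S j i)" by (simp add: S_def)
  qed
  obtain V s where V: "orthonormal n n V"
    and ev: "\<forall>a<n. \<forall>i<n. mv n S (V a) i = of_real (s a) * V a i"
    using hermitian_eigenbasis[OF hS] by blast
  define q where "q = (\<lambda>Z a. Re (ip n (mv n Z (V a)) (mv n Z (V a))))"
  define \<beta> where "\<beta> = (\<lambda>a. Re (ip n (V a) (mv n Z1 (V a))))"
  define I where "I = {a\<in>{..<n}. 0 < s a}"
  have diff: "mv n Z0 (V a) i = mv n Z1 (V a) i + of_real (s a) * V a i" if "a < n" "i < n" for a i
  proof -
    have "mv n Z0 (V a) i - mv n Z1 (V a) i = mv n S (V a) i"
      by (simp add: mv_def S_def left_diff_distrib sum_subtractf)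
    thus ?thesis using ev that by (simp add: algebra_simps)
  qed
  have one: "ip n (V a) (V a) = 1" if "a < n" for a
    using V that by (simp add: orthonormal_def)
  have q: "q Z0 a - q Z1 a = s a * (2 * \<beta> a + s a)" if "a < n" for a
    unfolding q_def \<beta>_def by (intro norm_shift_along diff one that)
  have \<beta>: "0 \<le> \<beta> a" "0 \<le> \<beta> a + s a" if "a < n" for a
  proof -
    show "0 \<le> \<beta> a" unfolding \<beta>_def by (rule p1)
    have "Re (ip n (V a) (mv n Z0 (V a))) = \<beta> a + s a"
      unfolding \<beta>_def by (intro norm_shift_along(2) diff one that)
    thus "0 \<le> \<beta> a + s a" using p0 by metis
  qed
  \<comment> \<open>The factor \<open>2 * \<beta> a + s a\<close> is the sum of the nonnegative
    forms of \<open>Z1\<close> and \<open>Z0\<close> at \<open>V a\<close>, which differ by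
    \<open>s a\<close>. It is therefore at least the modulus of \<open>s a\<close>, whatever the
    sign.\<close>
  have pos: "(s a)\<^sup>2 \<le> q Z0 a - q Z1 a" if "a \<in> I" for a
  proof -
    have a: "a < n" "0 < s a" using that by (auto simp: I_def)
    hence "s a * s a \<le> s a * (2 * \<beta> a + s a)" using \<beta> by (intro mult_left_mono) auto
    thus ?thesis using q a by (simp add: power2_eq_square)
  qed
  have neg: "(s a)\<^sup>2 \<le> - (q Z0 a - q Z1 a)" if "a \<in> {..<n} - I" for a
  proof -
    have a: "a < n" "s a \<le> 0" using that by (auto simp: I_def)
    hence "- s a * - s a \<le> - s a * (2 * \<beta> a + s a)"
      using \<beta>[of a] by (intro mult_left_mono) auto
    thus ?thesis using q[of a] a by (simp add: power2_eq_square)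
  qed
  have IS: "I \<subseteq> {..<n}" by (auto simp: I_def)
  \<comment> \<open>Both squares have trace 1, so the gains on \<open>I\<close> balance the losses
    outside it, and the sum over \<open>I\<close> is half of the total absolute difference.\<close>
  have sumq: "(\<Sum>a<n. q Z0 a - q Z1 a) = 0"
    unfolding sum_subtractf q_def using parseval_hermitian[OF V h0] parseval_hermitian[OF V h1] n0 n1 by simp
  have "(\<Sum>a<n. (s a)\<^sup>2) = (\<Sum>a\<in>I. (s a)\<^sup>2) + (\<Sum>a\<in>{..<n} - I. (s a)\<^sup>2)"
    using IS by (simp add: sum.subset_diff)
  also have "\<dots> \<le> (\<Sum>a\<in>I. q Z0 a - q Z1 a) + (\<Sum>a\<in>{..<n} - I. - (q Z0 a - q Z1 a))"
    using pos neg by (intro add_mono sum_mono) auto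
  also have "\<dots> = 2 * (\<Sum>a\<in>I. q Z0 a - q Z1 a)"
    unfolding sum_negf using sum.subset_diff[OF IS, of "\<lambda>a. q Z0 a - q Z1 a"] sumq by simp
  finally have le: "(\<Sum>a<n. (s a)\<^sup>2) \<le> 2 * (\<Sum>a\<in>I. q Z0 a - q Z1 a)" .
  \<comment> \<open>The squared eigenvalues add up to the squared Frobenius norm of
    \<open>Z0 - Z1\<close>; expanding it brings in the overlap.\<close>
  have "(\<Sum>a<n. (s a)\<^sup>2) = (\<Sum>a<n. Re (ip n (mv n S (V a)) (mv n S (V a))))"
  proof (intro sum.cong refl)
    fix a assume "a \<in> {..<n}"
    hence a: "a < n" by simp
    have "ip n (mv n S (V a)) (mv n S (V a)) = ip n (\<lambda>i. of_real (s a) * V a i) (\<lambda>i. of_real (s a) * V a i)"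
      using ev a by (intro ip_cong) auto
    also have "\<dots> = of_real ((s a)\<^sup>2)"
      by (simp add: ip_scale_left ip_scale_right one a power2_eq_square)
    finally show "(s a)\<^sup>2 = Re (ip n (mv n S (V a)) (mv n S (V a)))" by simp
  qed
  also have "\<dots> = (\<Sum>k<n. \<Sum>i<n. (cmod (S i k))\<^sup>2)"
    by (rule parseval_hermitian[OF V hS])
  also have "\<dots> = (\<Sum>k<n. \<Sum>i<n. (cmod (Z0 i k))\<^sup>2 + (cmod (Z1 i k))\<^sup>2 - 2 * Re (cnj (Z1 i k) * Z0 i k))"
    unfolding S_def cmod_power2 by (intro sum.cong refl) (simp add: power2_eq_square algebra_simps)
  also have "\<dots> = 2 - 2 * Re (\<Sum>k<n. \<Sum>i<n. cnj (Z1 i k) * Z0 i k)"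
    unfolding sum.distrib sum_subtractf by (simp add: n0 n1 Re_sum sum_distrib_left)
  finally show ?thesis using le V IS unfolding q_def by (intro exI[of _ V] exI[of _ I]) auto
qed

lemma cmod_orthonormal_le_1:
  assumes "orthonormal n n V" "a < n" "i < n"
  shows "cmod (V a i) \<le> 1"
proof -
  have "ip n (V a) (V a) = 1" using assms by (simp add: orthonormal_def)
  hence "(\<Sum>i<n. (cmod (V a i))\<^sup>2) = 1" unfolding ip_self of_real_eq_1_iff .
  moreover have "(cmod (V a i))\<^sup>2 \<le> (\<Sum>i<n. (cmod (V a i))\<^sup>2)"
    using assms by (intro member_le_sum) auto
  ultimately show ?thesis by (simp add: abs_square_le_1)
qed

text \<open>\<open>X0\<close> and \<open>X1\<close> are coefficient matrices of two honest
  commitments with rows indexed by C, and the sum of \<open>ip n (Z1 i) (Z0 i)\<close> is the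
  overlap F. The crude bound on the entries of \<open>M\<close> is uniform in the states; it later
  makes averages of such measurements over infinitely many guesses integrable.\<close>

lemma fidelity_pair:
  fixes X0 X1 :: "nat \<Rightarrow> nat \<Rightarrow> complex"
  assumes n0: "(\<Sum>i<n. \<Sum>r<m. (cmod (X0 i r))\<^sup>2) = 1" and n1: "(\<Sum>i<n. \<Sum>r<m. (cmod (X1 i r))\<^sup>2) = 1"
  shows "\<exists>Z0 Z1 M.
     (\<forall>i<n. \<forall>j<n. ip n (Z0 i) (Z0 j) = ip m (X0 i) (X0 j)) \<and>
     (\<forall>i<n. \<forall>j<n. ip n (Z1 i) (Z1 j) = ip m (X1 i) (X1 j)) \<and>
     hermitian n M \<and> (\<forall>u. 0 \<le> Re (ip n u (mv n M u)) \<and> Re (ip n u (mv n M u)) \<le> Re (ip n u u)) \<and>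
     (\<forall>i<n. \<forall>j<n. cmod (M i j) \<le> real n) \<and>
     (\<Sum>r<m. Re (ip n (\<lambda>i. X0 i r) (mv n M (\<lambda>i. X0 i r)))) - (\<Sum>r<m. Re (ip n (\<lambda>i. X1 i r) (mv n M (\<lambda>i. X1 i r))))
       \<ge> 1 - Re (\<Sum>i<n. ip n (Z1 i) (Z0 i))"
proof -
  have sqrt: "\<exists>Z. hermitian n Z \<and> (\<forall>u. 0 \<le> Re (ip n u (mv n Z u))) \<and>
      (\<forall>i<n. \<forall>j<n. ip n (Z i) (Z j) = ip m (X i) (X j)) \<and>
      (\<Sum>k<n. \<Sum>i<n. (cmod (Z i k))\<^sup>2) = 1 \<and>
      (\<forall>u. (\<Sum>r<m. (cmod (ip n u (\<lambda>i. X i r)))\<^sup>2) = Re (ip n (mv n Z u) (mv n Z u)))"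
    if norm: "(\<Sum>i<n. \<Sum>r<m. (cmod (X i r))\<^sup>2) = 1" for X :: "nat \<Rightarrow> nat \<Rightarrow> complex"
  proof -
    obtain Z where Z: "hermitian n Z" "\<forall>u. 0 \<le> Re (ip n u (mv n Z u))"
      and G: "\<forall>i<n. \<forall>j<n. (\<Sum>k<n. Z i k * cnj (Z j k)) = (\<Sum>r<m. X i r * cnj (X j r))"
      using psd_sqrt by blast
    have G': "ip n (Z i) (Z j) = ip m (X i) (X j)" if "i < n" "j < n" for i j
    proof -
      have "(\<Sum>k<n. Z j k * cnj (Z i k)) = (\<Sum>r<m. X j r * cnj (X i r))" using G that by blast
      thus ?thesis by (simp add: ip_def mult.commute)
    qed
    have "of_real (\<Sum>k<n. \<Sum>i<n. (cmod (Z i k))\<^sup>2) = (\<Sum>i<n. ip n (Z i) (Z i))"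
      by (subst sum.swap) (simp add: ip_self)
    also have "\<dots> = (\<Sum>i<n. ip m (X i) (X i))" by (intro sum.cong) (auto simp: G')
    also have "\<dots> = of_real (\<Sum>i<n. \<Sum>r<m. (cmod (X i r))\<^sup>2)" by (simp add: ip_self)
    finally have nZ: "(\<Sum>k<n. \<Sum>i<n. (cmod (Z i k))\<^sup>2) = 1" unfolding of_real_eq_iff norm .
    have "(\<Sum>r<m. (cmod (ip n u (\<lambda>i. X i r)))\<^sup>2) = Re (ip n (mv n Z u) (mv n Z u))" for u
    proof -
      have "complex_of_real (\<Sum>r<m. (cmod (ip n u (\<lambda>i. X i r)))\<^sup>2) =
            of_real (\<Sum>r<n. (cmod (ip n u (\<lambda>i. Z i r)))\<^sup>2)"
        unfolding of_real_sum sum_ip_gram using G by (intro sum.cong refl) simp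
      thus ?thesis unfolding of_real_eq_iff sum_hermitian_column[OF Z(1)] .
    qed
    thus ?thesis using Z G' nZ by blast
  qed
  obtain Z0 where h0: "hermitian n Z0" and p0: "\<forall>u. 0 \<le> Re (ip n u (mv n Z0 u))"
    and g0: "\<forall>i<n. \<forall>j<n. ip n (Z0 i) (Z0 j) = ip m (X0 i) (X0 j)"
    and f0: "(\<Sum>k<n. \<Sum>i<n. (cmod (Z0 i k))\<^sup>2) = 1"
    and m0: "\<forall>u. (\<Sum>r<m. (cmod (ip n u (\<lambda>i. X0 i r)))\<^sup>2) = Re (ip n (mv n Z0 u) (mv n Z0 u))"
    using sqrt[OF n0] by blast
  obtain Z1 where h1: "hermitian n Z1" and p1: "\<forall>u. 0 \<le> Re (ip n u (mv n Z1 u))"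
    and g1: "\<forall>i<n. \<forall>j<n. ip n (Z1 i) (Z1 j) = ip m (X1 i) (X1 j)"
    and f1: "(\<Sum>k<n. \<Sum>i<n. (cmod (Z1 i k))\<^sup>2) = 1"
    and m1: "\<forall>u. (\<Sum>r<m. (cmod (ip n u (\<lambda>i. X1 i r)))\<^sup>2) = Re (ip n (mv n Z1 u) (mv n Z1 u))"
    using sqrt[OF n1] by blast
  obtain V I where V: "orthonormal n n V" and I: "I \<subseteq> {..<n}"
    and adv: "(\<Sum>a\<in>I. Re (ip n (mv n Z0 (V a)) (mv n Z0 (V a))) - Re (ip n (mv n Z1 (V a)) (mv n Z1 (V a))))
       \<ge> 1 - Re (\<Sum>k<n. \<Sum>i<n. cnj (Z1 i k) * Z0 i k)"
    using powers_stormer[OF h0 h1 p0[rule_format] p1[rule_format] f0 f1] by blast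
  define M where "M = spectral_mat n V (\<lambda>a. if a \<in> I then 1 else 0)"
  have qM: "Re (ip n u (mv n M u)) = (\<Sum>a\<in>I. (cmod (ip n (V a) u))\<^sup>2)" for u
  proof -
    have "Re (ip n u (mv n M u)) = (\<Sum>a<n. if a \<in> I then (cmod (ip n (V a) u))\<^sup>2 else 0)"
      unfolding M_def ip_mv_spectral_mat Re_complex_of_real by (intro sum.cong) auto
    also have "\<dots> = (\<Sum>a\<in>I. (cmod (ip n (V a) u))\<^sup>2)"
      using I by (simp add: sum.If_cases Int_absorb1)
    finally show ?thesis .
  qed
  have "Re (ip n u (mv n M u)) \<le> Re (ip n u u)" for u
    unfolding qM parseval[OF V, symmetric] using I by (intro sum_mono2) auto
  moreover have "0 \<le> Re (ip n u (mv n M u))" for u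
    unfolding qM by (intro sum_nonneg) auto
  moreover have "cmod (M i j) \<le> real n" if "i < n" "j < n" for i j
  proof -
    have "cmod (M i j) \<le> (\<Sum>a<n. 1)"
      unfolding M_def spectral_mat_def
    proof (rule order_trans[OF norm_sum], intro sum_mono)
      fix a assume "a \<in> {..<n}"
      hence "cmod (V a i) * cmod (V a j) \<le> 1 * 1"
        using cmod_orthonormal_le_1[OF V] that by (intro mult_mono) auto
      thus "cmod (of_real (if a \<in> I then 1 else 0) * (V a i * cnj (V a j))) \<le> 1"
        by (simp add: norm_mult)
    qed
    thus ?thesis by simp
  qed
  moreover have "(\<Sum>r<m. Re (ip n (\<lambda>i. X0 i r) (mv n M (\<lambda>i. X0 i r)))) -
      (\<Sum>r<m. Re (ip n (\<lambda>i. X1 i r) (mv n M (\<lambda>i. X1 i r)))) \<ge> 1 - Re (\<Sum>i<n. ip n (Z1 i) (Z0 i))"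
  proof -
    \<comment> \<open>Measuring the state on C and measuring its reduced state agree: each
      \<open>V a\<close> contributes the squared norm of its image under the square root.\<close>
    have "(\<Sum>r<m. Re (ip n (\<lambda>i. X0 i r) (mv n M (\<lambda>i. X0 i r)))) = (\<Sum>a\<in>I. Re (ip n (mv n Z0 (V a)) (mv n Z0 (V a))))"
      unfolding qM by (subst sum.swap) (simp add: m0)
    moreover have "(\<Sum>r<m. Re (ip n (\<lambda>i. X1 i r) (mv n M (\<lambda>i. X1 i r)))) = (\<Sum>a\<in>I. Re (ip n (mv n Z1 (V a)) (mv n Z1 (V a))))"
      unfolding qM by (subst sum.swap) (simp add: m1)
    moreover have "(\<Sum>k<n. \<Sum>i<n. cnj (Z1 i k) * Z0 i k) = (\<Sum>i<n. ip n (Z1 i) (Z0 i))"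
      unfolding ip_def by (rule sum.swap)
    ultimately show ?thesis using adv by (simp add: sum_subtractf)
  qed
  moreover have "hermitian n M" unfolding M_def by (rule hermitian_spectral_mat)
  ultimately show ?thesis
    using g0 g1 by (intro exI[of _ Z0] exI[of _ Z1] exI[of _ M] conjI allI impI) simp_all
qed

section \<open>Matrices, tensor products and measurement probabilities\<close>

lemma sum_lessThan_mult:
  fixes f :: "nat \<Rightarrow> 'a::comm_monoid_add"
  shows "(\<Sum>t<n*k. f t) = (\<Sum>i<n. \<Sum>e<k. f (i * k + e))"
proof -
  have "sum f {i*k..<i*k+k} = (\<Sum>e<k. f (i * k + e))" for i
    using sum.shift_bounds_nat_ivl[of f 0 "i*k" k] by (simp add: atLeast0LessThan add.commute)
  thus ?thesis by (simp flip: sum.nat_group)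
qed

lemma index_lt: "i < n \<Longrightarrow> e < k \<Longrightarrow> i * k + e < n * (k::nat)"
  by (metis add.commute add_less_cancel_left less_le_trans mult_Suc mult_le_mono1 Suc_leI)

abbreviation vfun :: "complex Matrix.vec \<Rightarrow> nat \<Rightarrow> complex" where
  "vfun v \<equiv> (\<lambda>i. vec_index v i)"

abbreviation mfun :: "complex mat \<Rightarrow> nat \<Rightarrow> nat \<Rightarrow> complex" where
  "mfun M \<equiv> (\<lambda>i j. M $$ (i, j))"

lemma cinner_ip: "v \<in> carrier_vec n \<Longrightarrow> cinner v w = ip n (vfun v) (vfun w)"
  by (auto simp: cinner_def ip_def)

lemma mult_mat_vec_mv:
  "A \<in> carrier_mat n k \<Longrightarrow> v \<in> carrier_vec k \<Longrightarrow> i < n \<Longrightarrow> (A *\<^sub>v v) $ i = mv k (mfun A) (vfun v) i"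
  by (auto simp: mv_def scalar_prod_def atLeast0LessThan)

lemma meas_prob_ip:
  assumes "A \<in> carrier_mat n n" "v \<in> carrier_vec n"
  shows "meas_prob A v = Re (ip n (vfun v) (mv n (mfun A) (vfun v)))"
  unfolding meas_prob_def cinner_ip[OF assms(2)]
  by (intro arg_cong[of _ _ Re] ip_cong mult_mat_vec_mv[OF assms]) auto

lemma povm_elem_ip:
  assumes M: "M \<in> carrier_mat n n"
  shows "povm_elem n M \<longleftrightarrow> hermitian n (mfun M) \<and>
    (\<forall>u. 0 \<le> Re (ip n u (mv n (mfun M) u)) \<and> Re (ip n u (mv n (mfun M) u)) \<le> Re (ip n u u))"
proof -
  have "adj M = M \<longleftrightarrow> hermitian n (mfun M)"
  proof
    assume *: "adj M = M"
    show "hermitian n (mfun M)"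
      unfolding hermitian_def
    proof (intro allI impI)
      fix i j assume "i < n" "j < n"
      hence "adj M $$ (i,j) = cnj (M $$ (j,i))" using M by (simp add: adj_def)
      thus "M $$ (i,j) = cnj (M $$ (j,i))" using * by simp
    qed
  next
    assume h: "hermitian n (mfun M)"
    show "adj M = M"
    proof (rule eq_matI)
      fix i j assume ij: "i < dim_row M" "j < dim_col M"
      hence "i < n" "j < n" using M by auto
      hence "M $$ (i,j) = cnj (M $$ (j,i))" using h unfolding hermitian_def by blast
      thus "adj M $$ (i,j) = M $$ (i,j)" using ij M by (simp add: adj_def)
    qed (use M in \<open>auto simp: adj_def\<close>)
  qed
  moreover have "(\<forall>v\<in>carrier_vec n. 0 \<le> Re (cinner v (M *\<^sub>v v)) \<and> Re (cinner v (M *\<^sub>v v)) \<le> Re (cinner v v)) \<longleftrightarrow>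
    (\<forall>u. 0 \<le> Re (ip n u (mv n (mfun M) u)) \<and> Re (ip n u (mv n (mfun M) u)) \<le> Re (ip n u u))" (is "?L \<longleftrightarrow> ?R")
  proof
    assume R: ?R
    show ?L
    proof
      fix v :: "complex Matrix.vec" assume v: "v \<in> carrier_vec n"
      show "0 \<le> Re (cinner v (M *\<^sub>v v)) \<and> Re (cinner v (M *\<^sub>v v)) \<le> Re (cinner v v)"
        using R meas_prob_ip[OF M v] cinner_ip[OF v] by (simp add: meas_prob_def)
    qed
  next
    assume L: ?L
    show ?R
    proof
      fix u :: "nat \<Rightarrow> complex"
      have v: "Matrix.vec n u \<in> carrier_vec n" by simp
      have e: "ip n (vfun (Matrix.vec n u)) w = ip n u w" for w by (rule ip_cong) auto
      have "ip n u u = ip n (vfun (Matrix.vec n u)) (vfun (Matrix.vec n u))" by (rule ip_cong) auto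
      moreover have "mv n (mfun M) (vfun (Matrix.vec n u)) = mv n (mfun M) u"
        by (rule ext, rule mv_cong) auto
      ultimately show "0 \<le> Re (ip n u (mv n (mfun M) u)) \<and> Re (ip n u (mv n (mfun M) u)) \<le> Re (ip n u u)"
        using bspec[OF L v] meas_prob_ip[OF M v] cinner_ip[OF v] by (simp add: meas_prob_def e)
    qed
  qed
  ultimately show ?thesis using M unfolding povm_elem_def by blast
qed

lemma unitary_mat_ip:
  assumes U: "U \<in> carrier_mat n n"
  shows "unitary_mat n U \<longleftrightarrow> (\<forall>u v. ip n (mv n (mfun U) u) (mv n (mfun U) v) = ip n u v)"
proof
  assume "unitary_mat n U"
  hence *: "adj U * U = 1\<^sub>m n" by (simp add: unitary_mat_def)
  have g: "(\<Sum>k<n. cnj (U $$ (k,i)) * U $$ (k,j)) = (if i = j then 1 else 0)" if "i < n" "j < n" for i j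
  proof -
    have "(adj U * U) $$ (i,j) = (\<Sum>k<n. cnj (U $$ (k,i)) * U $$ (k,j))"
      using U that by (simp add: adj_def scalar_prod_def atLeast0LessThan)
    thus ?thesis using that by (simp add: *)
  qed
  show "\<forall>u v. ip n (mv n (mfun U) u) (mv n (mfun U) v) = ip n u v"
  proof (intro allI)
    fix u v
    have "ip n (mv n (mfun U) u) (mv n (mfun U) v) =
        (\<Sum>k<n. \<Sum>i<n. \<Sum>j<n. cnj (u i) * v j * (cnj (U $$ (k,i)) * U $$ (k,j)))"
      unfolding ip_def mv_def cnj_sum sum_product
      by (intro sum.cong refl) (simp add: mult_ac)
    also have "\<dots> = (\<Sum>i<n. \<Sum>k<n. \<Sum>j<n. cnj (u i) * v j * (cnj (U $$ (k,i)) * U $$ (k,j)))"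
      by (rule sum.swap)
    also have "\<dots> = (\<Sum>i<n. \<Sum>j<n. \<Sum>k<n. cnj (u i) * v j * (cnj (U $$ (k,i)) * U $$ (k,j)))"
      by (rule sum.cong[OF refl]) (rule sum.swap)
    also have "\<dots> = (\<Sum>i<n. \<Sum>j<n. if j = i then cnj (u i) * v i else 0)"
      unfolding sum_distrib_left[symmetric] by (intro sum.cong refl) (auto simp: g)
    also have "\<dots> = ip n u v" by (simp add: ip_def)
    finally show "ip n (mv n (mfun U) u) (mv n (mfun U) v) = ip n u v" .
  qed
next
  assume iso: "\<forall>u v. ip n (mv n (mfun U) u) (mv n (mfun U) v) = ip n u v"
  define e :: "nat \<Rightarrow> nat \<Rightarrow> complex" where "e = (\<lambda>i k. if k = i then 1 else 0)"
  have me: "mv n (mfun U) (e i) k = U $$ (k,i)" if "i < n" for i k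
    using that by (simp add: mv_def e_def if_distrib[of "\<lambda>x. _ * x"] cong: if_cong)
  have "adj U * U = 1\<^sub>m n"
  proof (rule eq_matI)
    fix i j assume "i < dim_row (1\<^sub>m n :: complex mat)" "j < dim_col (1\<^sub>m n :: complex mat)"
    hence ij: "i < n" "j < n" by auto
    have "(adj U * U) $$ (i,j) = (\<Sum>k<n. cnj (U $$ (k,i)) * U $$ (k,j))"
      using U ij by (simp add: adj_def scalar_prod_def atLeast0LessThan)
    also have "\<dots> = ip n (mv n (mfun U) (e i)) (mv n (mfun U) (e j))"
      by (simp add: ip_def me ij)
    also have "\<dots> = ip n (e i) (e j)" using iso by simp
    also have "\<dots> = (\<Sum>k<n. if k = i then e j i else 0)"
      unfolding ip_def by (intro sum.cong) (auto simp: e_def)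
    also have "\<dots> = 1\<^sub>m n $$ (i,j)" using ij by (simp add: e_def)
    finally show "(adj U * U) $$ (i,j) = 1\<^sub>m n $$ (i,j)" .
  qed (use U in \<open>auto simp: adj_def\<close>)
  thus "unitary_mat n U" using U by (simp add: unitary_mat_def)
qed

lemma kron_one_right_index:
  assumes A: "A \<in> carrier_mat n n" and v: "v \<in> carrier_vec (n * k)" and ie: "i < n" "e < k"
  shows "(kron A (1\<^sub>m k) *\<^sub>v v) $ (i * k + e) = mv n (mfun A) (\<lambda>j. v $ (j * k + e)) i"
proof -
  have "(kron A (1\<^sub>m k) *\<^sub>v v) $ (i * k + e) =
      (\<Sum>t<n*k. A $$ (i, t div k) * (if e = t mod k then 1 else 0) * v $ t)"
    using assms index_lt[OF ie]
    by (auto simp: kron_def scalar_prod_def atLeast0LessThan intro!: sum.cong)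
  also have "\<dots> = (\<Sum>j<n. \<Sum>e'<k. A $$ (i, j) * (if e = e' then 1 else 0) * v $ (j * k + e'))"
    unfolding sum_lessThan_mult by (intro sum.cong refl) auto
  also have "\<dots> = (\<Sum>j<n. \<Sum>e'<k. if e' = e then A $$ (i, j) * v $ (j * k + e) else 0)"
    by (intro sum.cong refl) auto
  also have "\<dots> = mv n (mfun A) (\<lambda>j. v $ (j * k + e)) i"
    using ie by (simp add: mv_def)
  finally show ?thesis .
qed

lemma kron_one_left_index:
  assumes U: "U \<in> carrier_mat m m" and v: "v \<in> carrier_vec (n * m)" and cr: "c < n" "r < m"
  shows "(kron (1\<^sub>m n) U *\<^sub>v v) $ (c * m + r) = mv m (mfun U) (\<lambda>j. v $ (c * m + j)) r"
proof -
  have "(kron (1\<^sub>m n) U *\<^sub>v v) $ (c * m + r) =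
      (\<Sum>t<n*m. (if c = t div m then 1 else 0) * U $$ (r, t mod m) * v $ t)"
    using assms index_lt[OF cr]
    by (auto simp: kron_def scalar_prod_def atLeast0LessThan less_mult_imp_div_less intro!: sum.cong)
  also have "\<dots> = (\<Sum>d<n. \<Sum>j<m. (if c = d then 1 else 0) * U $$ (r, j) * v $ (d * m + j))"
    unfolding sum_lessThan_mult by (intro sum.cong refl) auto
  also have "\<dots> = (\<Sum>d<n. if d = c then \<Sum>j<m. U $$ (r, j) * v $ (c * m + j) else 0)"
    by (intro sum.cong refl) auto
  also have "\<dots> = mv m (mfun U) (\<lambda>j. v $ (c * m + j)) r"
    using cr by (simp add: mv_def)
  finally show ?thesis .
qed

lemma kron_one_left_carrier: "U \<in> carrier_mat m m \<Longrightarrow> kron (1\<^sub>m n) U \<in> carrier_mat (n * m) (n * m)"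
  by (auto simp: kron_def)

lemma ip_mult_dim:
  "ip (n * k) u v = (\<Sum>e<k. ip n (\<lambda>i. u (i * k + e)) (\<lambda>i. v (i * k + e)))"
  unfolding ip_def sum_lessThan_mult by (rule sum.swap)

text \<open>Used for two splittings: C against R when the receiver distinguishes, and C with R
  against E' when the receiver verifies.\<close>

lemma meas_prob_kron_one:
  assumes A: "A \<in> carrier_mat n n" and v: "v \<in> carrier_vec (n * k)"
  shows "meas_prob (kron A (1\<^sub>m k)) v =
    (\<Sum>e<k. Re (ip n (\<lambda>i. v $ (i * k + e)) (mv n (mfun A) (\<lambda>i. v $ (i * k + e)))))"
proof -
  have "cinner v (kron A (1\<^sub>m k) *\<^sub>v v) =
      (\<Sum>e<k. ip n (\<lambda>i. v $ (i * k + e)) (mv n (mfun A) (\<lambda>i. v $ (i * k + e))))"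
    unfolding cinner_ip[OF v] ip_mult_dim
    by (intro sum.cong refl ip_cong) (auto simp: kron_one_right_index[OF A v])
  thus ?thesis by (simp add: meas_prob_def)
qed

lemma meas_prob_kron_one_bounds:
  assumes A: "povm_elem n A" and v: "v \<in> carrier_vec (n * k)"
  shows "0 \<le> meas_prob (kron A (1\<^sub>m k)) v" "meas_prob (kron A (1\<^sub>m k)) v \<le> Re (cinner v v)"
proof -
  have c: "A \<in> carrier_mat n n" using A by (simp add: povm_elem_def)
  note p = A[unfolded povm_elem_ip[OF c]]
  show "0 \<le> meas_prob (kron A (1\<^sub>m k)) v"
    unfolding meas_prob_kron_one[OF c v] using p by (intro sum_nonneg) auto
  show "meas_prob (kron A (1\<^sub>m k)) v \<le> Re (cinner v v)"
    unfolding meas_prob_kron_one[OF c v] cinner_ip[OF v] ip_mult_dim Re_sum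
    using p by (intro sum_mono) auto
qed

text \<open>Keeps the cheater's state normalised, so that its acceptance probabilities are at most 1
  and hence integrable.\<close>

lemma cinner_kron_unitary:
  assumes U: "unitary_mat m U" and v: "v \<in> carrier_vec (n * m)"
  shows "cinner (kron (1\<^sub>m n) U *\<^sub>v v) (kron (1\<^sub>m n) U *\<^sub>v v) = cinner v v"
proof -
  have c: "U \<in> carrier_mat m m" using U by (simp add: unitary_mat_def)
  have k: "kron (1\<^sub>m n) U *\<^sub>v v \<in> carrier_vec (n * m)" using mult_mat_vec_carrier[OF kron_one_left_carrier[OF c] v] .
  have rows: "ip (n * m) u w = (\<Sum>i<n. ip m (\<lambda>j. u (i * m + j)) (\<lambda>j. w (i * m + j)))" for u w
    unfolding ip_def sum_lessThan_mult ..
  have "ip m (\<lambda>j. (kron (1\<^sub>m n) U *\<^sub>v v) $ (i * m + j)) (\<lambda>j. (kron (1\<^sub>m n) U *\<^sub>v v) $ (i * m + j)) =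
      ip m (mv m (mfun U) (\<lambda>j. v $ (i * m + j))) (mv m (mfun U) (\<lambda>j. v $ (i * m + j)))" if "i < n" for i
    using that by (intro ip_cong) (auto simp: kron_one_left_index[OF c v])
  thus ?thesis unfolding cinner_ip[OF v] cinner_ip[OF k] rows
    using U[unfolded unitary_mat_ip[OF c]] by simp
qed

text \<open>A state accepted with certainty is fixed by the POVM element, because \<open>1 - L\<close> is positive
  semidefinite and vanishes on it.\<close>

lemma certain_accept:
  assumes L: "hermitian n L" "\<And>u. 0 \<le> Re (ip n u (mv n L u))" "\<And>u. Re (ip n u (mv n L u)) \<le> Re (ip n u u)"
    and w: "ip n w w = 1" "Re (ip n w (mv n L w)) = 1"
  shows "(cmod (ip n w v))\<^sup>2 \<le> Re (ip n v (mv n L v))"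
proof -
  have lin: "mv n L (\<lambda>i. u i + c * w i) = (\<lambda>i. mv n L u i + c * mv n L w i)" for u c
    by (rule ext) (simp add: mv_def algebra_simps sum.distrib sum_distrib_left)
  have addl: "ip n (\<lambda>i. u i + c * w i) z = ip n u z + cnj c * ip n w z" for u z c
    by (simp add: ip_def algebra_simps sum.distrib sum_distrib_left)
  define a b where "a = ip n w v" and "b = ip n w (mv n L v)"
  have va: "ip n v w = cnj a" by (simp add: a_def cnj_ip)
  have vb: "ip n v (mv n L w) = cnj b"
    by (simp add: b_def cnj_ip hermitian_swap[OF L(1), symmetric])
  have q: "Re (ip n (\<lambda>i. v i + c * w i) (mv n L (\<lambda>i. v i + c * w i))) =
      Re (ip n v (mv n L v)) + 2 * Re (cnj c * b) + (cmod c)\<^sup>2" for c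
  proof -
    have "Im (ip n w (mv n L w)) = 0"
      using cnj_ip[of n w "mv n L w"] hermitian_swap[OF L(1), of w w] by (simp add: complex_eq_iff)
    hence "ip n w (mv n L w) = 1" using w by (simp add: complex_eq_iff)
    thus ?thesis
      by (simp add: lin addl ip_add_right ip_scale_right vb flip: b_def)
        (simp add: cmod_power2[unfolded power2_eq_square] power2_eq_square algebra_simps)
  qed
  have r: "Re (ip n (\<lambda>i. v i + c * w i) (\<lambda>i. v i + c * w i)) =
      Re (ip n v v) + 2 * Re (cnj c * a) + (cmod c)\<^sup>2" for c
    by (simp add: addl ip_add_right ip_scale_right va w flip: a_def)
      (simp add: cmod_power2[unfolded power2_eq_square] power2_eq_square algebra_simps)
  \<comment> \<open>At \<open>v + c * w\<close> the form of \<open>1 - L\<close> has no quadratic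
    term in \<open>c\<close>, because it vanishes at \<open>w\<close>. A real-affine function of
    \<open>c\<close> that is nonnegative everywhere has no linear part, and here that part is given
    by \<open>a - b\<close>.\<close>
  have "a = b"
  proof (rule ccontr)
    assume ne: "a \<noteq> b"
    define g where "g = Re (ip n v v) - Re (ip n v (mv n L v))"
    have ge: "0 \<le> g + 2 * Re (cnj c * (a - b))" for c
      using L(3)[of "\<lambda>i. v i + c * w i"] unfolding q r g_def by (simp add: right_diff_distrib)
    \<comment> \<open>Chosen so that the nonnegative quantity above would take the value -1.\<close>
    define t where "t = (g + 1) / (2 * (cmod (a - b))\<^sup>2)"
    have "cnj (a - b) * (a - b) = of_real ((cmod (a - b))\<^sup>2)"
      by (simp add: complex_norm_square mult.commute del: of_real_power)
    hence E: "cnj (- of_real t * (a - b)) * (a - b) = of_real (- t * (cmod (a - b))\<^sup>2)"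
      by simp
    have "0 \<le> g + 2 * (- t * (cmod (a - b))\<^sup>2)"
      using ge[of "- of_real t * (a - b)"] unfolding E Re_complex_of_real .
    thus False using ne by (simp add: t_def field_simps)
  qed
  \<comment> \<open>Positivity of \<open>L\<close> at the part of \<open>v\<close> orthogonal to
    \<open>w\<close>; since \<open>b\<close> is \<open>a\<close>, the cross term takes away twice
    the squared modulus of \<open>a\<close> and the quadratic term gives it back once.\<close>
  have "0 \<le> Re (ip n v (mv n L v)) + 2 * Re (cnj (- a) * b) + (cmod (- a))\<^sup>2"
    using L(2)[of "\<lambda>i. v i + (- a) * w i"] unfolding q by simp
  hence "(cmod a)\<^sup>2 \<le> Re (ip n v (mv n L v))"
    unfolding \<open>a = b\<close>[symmetric] by (simp add: cmod_power2[unfolded power2_eq_square] power2_eq_square algebra_simps)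
  thus ?thesis by (simp add: a_def)
qed

section \<open>Attacks for a fixed x\<close>

lemma index_div: "e < k \<Longrightarrow> (i * k + e) div k = (i::nat)"
  by simp

lemma unitary_mat_of_isometry:
  assumes "\<forall>u v. ip N (mv N W u) (mv N W v) = ip N u v"
  shows "unitary_mat N (Matrix.mat N N (\<lambda>(i, j). W i j))"
    and "i < N \<Longrightarrow> mv N (mfun (Matrix.mat N N (\<lambda>(i, j). W i j))) u i = mv N W u i"
proof -
  have e: "mv N (mfun (Matrix.mat N N (\<lambda>(i, j). W i j))) u i = mv N W u i" if "i < N" for u i
    unfolding mv_def using that by (intro sum.cong) auto
  thus "i < N \<Longrightarrow> mv N (mfun (Matrix.mat N N (\<lambda>(i, j). W i j))) u i = mv N W u i" .
  have c: "Matrix.mat N N (\<lambda>(i, j). W i j) \<in> carrier_mat N N" by simp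
  show "unitary_mat N (Matrix.mat N N (\<lambda>(i, j). W i j))"
    unfolding unitary_mat_ip[OF c]
  proof (intro allI)
    fix u v
    show "ip N (mv N (mfun (Matrix.mat N N (\<lambda>(i, j). W i j))) u) (mv N (mfun (Matrix.mat N N (\<lambda>(i, j). W i j))) v) = ip N u v"
      by (rule trans[OF ip_cong assms[rule_format]]; rule e)
  qed
qed

lemma pure_state_norm:
  fixes P :: "complex Matrix.vec"
  assumes "pure_state (n * m) P"
  shows "(\<Sum>i<n. \<Sum>r<m. (cmod (P $ (i * m + r)))\<^sup>2) = 1"
proof -
  have "ip (n * m) (vfun P) (vfun P) = 1"
    using assms cinner_ip[of P "n * m" P] by (simp add: pure_state_def)
  hence "(\<Sum>i<n*m. (cmod (P $ i))\<^sup>2) = 1" unfolding ip_self of_real_eq_1_iff .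
  thus ?thesis by (simp add: sum_lessThan_mult)
qed

text \<open>The environment of the committer is \<open>E = R \<otimes> E'\<close> with \<open>dim E' = n = dim C\<close>, large enough to hold the
  purification \<open>\<Sum>c. |c\<rangle> |Y c\<rangle>\<close> in its first \<open>n\<close> basis states. The unitary maps \<open>\<Sum>c. |c\<rangle> |Z c\<rangle>\<close> to
  \<open>P \<otimes> |0\<rangle>\<close> and hence preserves the overlap of \<open>Y\<close> with \<open>Z\<close>.\<close>

lemma cheating_committer:
  fixes P :: "complex Matrix.vec"
  assumes P: "pure_state (n * m) P"
    and Z: "\<forall>i<n. \<forall>j<n. ip n (Z i) (Z j) = ip m (\<lambda>r. P $ (i * m + r)) (\<lambda>r. P $ (j * m + r))"
  shows "\<exists>U. unitary_mat (m * n) U \<and>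
     (\<forall>Y L. povm_elem (n * m) L \<longrightarrow> meas_prob L P = 1 \<longrightarrow>
        (cmod (\<Sum>i<n. ip n (Z i) (Y i)))\<^sup>2 \<le> meas_prob (kron L (1\<^sub>m n))
          (kron (1\<^sub>m n) U *\<^sub>v Matrix.vec (n * (m * n))
             (\<lambda>t. if t mod (m * n) < n then Y (t div (m * n)) (t mod (m * n)) else 0)))"
proof -
  define N where "N = m * n"
  have Pc: "P \<in> carrier_vec (n * m)" using P by (simp add: pure_state_def)
  \<comment> \<open>A unit vector excludes dimension zero. Then E has dimension at least
    \<open>n\<close>, as the padding requires.\<close>
  have "n * m \<noteq> 0" using pure_state_norm[OF P] by (intro notI) auto
  hence m: "0 < m" and n: "0 < n" by auto
  have nN: "n \<le> N" using m by (simp add: N_def)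
  \<comment> \<open>\<open>pad\<close> embeds the rows of a square root into E. Row
    \<open>y c\<close> is row \<open>c\<close> of \<open>P\<close> with E' in its first basis state:
    an index \<open>k\<close> of E stands for the pair of \<open>k div n\<close> in R and
    \<open>k mod n\<close> in E'.\<close>
  define pad :: "(nat \<Rightarrow> complex) \<Rightarrow> nat \<Rightarrow> complex" where "pad = (\<lambda>u k. if k < n then u k else 0)"
  define y where "y = (\<lambda>c k. if k mod n = 0 then P $ (c * m + k div n) else 0)"
  have ip_pad: "ip N (pad u) (pad v) = ip n u v" for u v
  proof -
    have "ip N (pad u) (pad v) = (\<Sum>k\<in>{..<n}. cnj (pad u k) * pad v k)"
      unfolding ip_def using nN by (intro sum.mono_neutral_right) (auto simp: pad_def)
    thus ?thesis by (simp add: ip_def pad_def)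
  qed
  have ip_y: "ip N (y c) w = ip m (\<lambda>r. P $ (c * m + r)) (\<lambda>r. w (r * n))" for c w
  proof -
    have "ip N (y c) w = (\<Sum>r<m. \<Sum>e<n. if e = 0 then cnj (P $ (c * m + r)) * w (r * n) else 0)"
      unfolding ip_def N_def sum_lessThan_mult by (intro sum.cong refl) (auto simp: y_def)
    thus ?thesis using n by (simp add: ip_def)
  qed
  have G: "ip N (pad (Z i)) (pad (Z j)) = ip N (y i) (y j)" if "i < n" "j < n" for i j
  proof -
    have "ip N (y i) (y j) = ip m (\<lambda>r. P $ (i * m + r)) (\<lambda>r. P $ (j * m + r))"
      unfolding ip_y using n by (intro ip_cong) (auto simp: y_def)
    thus ?thesis using Z that by (simp add: ip_pad)
  qed
  from gram_unitary[of n N "\<lambda>c. pad (Z c)" y, OF G] obtain W where iso: "\<forall>u v. ip N (mv N W u) (mv N W v) = ip N u v"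
    and W: "\<forall>c<n. \<forall>i<N. mv N W (pad (Z c)) i = y c i"
    by blast
  define U where "U = Matrix.mat N N (\<lambda>(i, j). W i j)"
  have U: "unitary_mat N U" unfolding U_def by (rule unitary_mat_of_isometry(1)[OF iso])
  have Uc: "U \<in> carrier_mat N N" by (simp add: U_def)
  have "(cmod (\<Sum>i<n. ip n (Z i) (Y i)))\<^sup>2 \<le> meas_prob (kron L (1\<^sub>m n)) (kron (1\<^sub>m n) U *\<^sub>v Phi)"
    if L: "povm_elem (n * m) L" and LP: "meas_prob L P = 1"
      and Phi: "Phi = Matrix.vec (n * N) (\<lambda>t. if t mod N < n then Y (t div N) (t mod N) else 0)" for Y L Phi
  proof -
    define v where "v = kron (1\<^sub>m n) U *\<^sub>v Phi"
    have Phic: "Phi \<in> carrier_vec (n * N)" by (simp add: Phi)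
    have vN: "v \<in> carrier_vec (n * N)"
      unfolding v_def by (rule mult_mat_vec_carrier[OF kron_one_left_carrier[OF Uc] Phic])
    \<comment> \<open>The same vector is read as a state on C and E, where the unitary acts, and on
      C R and E', where the receiver measures.\<close>
    have "n * N = n * m * n" by (simp add: N_def)
    from vN[unfolded this] have vc: "v \<in> carrier_vec (n * m * n)" .
    have v: "v $ (c * N + k) = mv N W (pad (Y c)) k" if ck: "c < n" "k < N" for c k
    proof -
      have "v $ (c * N + k) = mv N (mfun U) (\<lambda>j. Phi $ (c * N + j)) k"
        unfolding v_def by (rule kron_one_left_index[OF Uc Phic ck])
      also have "\<dots> = mv N (mfun U) (pad (Y c)) k"
        using ck by (intro mv_cong) (simp add: Phi pad_def index_lt)
      also have "\<dots> = mv N W (pad (Y c)) k"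
        unfolding U_def by (rule unitary_mat_of_isometry(2)[OF iso ck(2)])
      finally show ?thesis .
    qed
    \<comment> \<open>The component with E' in its first basis state, the only one that overlaps
      with the target.\<close>
    define w where "w = (\<lambda>t. v $ (t * n + 0))"
    have Lc: "L \<in> carrier_mat (n * m) (n * m)" using L by (simp add: povm_elem_def)
    note Lp = L[unfolded povm_elem_ip[OF Lc]]
    have "ip (n * m) (vfun P) w = (\<Sum>c<n. ip m (\<lambda>r. P $ (c * m + r)) (\<lambda>r. w (c * m + r)))"
      unfolding ip_def sum_lessThan_mult ..
    also have "\<dots> = (\<Sum>c<n. ip n (Z c) (Y c))"
    proof (intro sum.cong refl)
      fix c assume "c \<in> {..<n}"
      hence c: "c < n" by simp
      have "w (c * m + r) = mv N W (pad (Y c)) (r * n)" if "r < m" for r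
      proof -
        have "(c * m + r) * n + 0 = c * N + r * n" by (simp add: N_def algebra_simps)
        moreover have "r * n < N" using that n by (simp add: N_def)
        ultimately show ?thesis using v[OF c] by (simp add: w_def)
      qed
      hence "ip m (\<lambda>r. P $ (c * m + r)) (\<lambda>r. w (c * m + r)) = ip N (y c) (mv N W (pad (Y c)))"
        unfolding ip_y by (intro ip_cong) auto
      also have "\<dots> = ip N (mv N W (pad (Z c))) (mv N W (pad (Y c)))"
        using W c by (intro ip_cong) auto
      also have "\<dots> = ip n (Z c) (Y c)" using iso by (simp add: ip_pad)
      finally show "ip m (\<lambda>r. P $ (c * m + r)) (\<lambda>r. w (c * m + r)) = ip n (Z c) (Y c)" .
    qed
    finally have ov: "ip (n * m) (vfun P) w = (\<Sum>c<n. ip n (Z c) (Y c))" .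
    have PP: "ip (n * m) (vfun P) (vfun P) = 1"
      using P cinner_ip[OF Pc] by (simp add: pure_state_def)
    have PL: "Re (ip (n * m) (vfun P) (mv (n * m) (mfun L) (vfun P))) = 1"
      using LP meas_prob_ip[OF Lc Pc] by simp
    have "(cmod (ip (n * m) (vfun P) w))\<^sup>2 \<le> Re (ip (n * m) w (mv (n * m) (mfun L) w))"
      using Lp by (intro certain_accept PP PL) auto
    \<comment> \<open>The remaining components of E' only add nonnegative acceptance
      probability.\<close>
    also have "\<dots> \<le> (\<Sum>e<n. Re (ip (n * m) (\<lambda>i. v $ (i * n + e)) (mv (n * m) (mfun L) (\<lambda>i. v $ (i * n + e)))))"
      unfolding w_def using n Lp by (intro member_le_sum[of 0 "{..<n}" "\<lambda>e. Re (ip (n * m) (\<lambda>i. v $ (i * n + e)) (mv (n * m) (mfun L) (\<lambda>i. v $ (i * n + e))))"]) auto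
    also have "\<dots> = meas_prob (kron L (1\<^sub>m n)) v"
      by (rule meas_prob_kron_one[OF Lc vc, symmetric])
    finally show ?thesis by (simp add: ov v_def)
  qed
  thus ?thesis using U unfolding N_def by blast
qed

text \<open>State, unitaries and measurement are fixed before \<open>L\<close> is quantified, since
  the committer must not depend on y. \<open>F\<close> is the real part of the overlap of the square
  roots; its square is bounded by that of the modulus.\<close>

lemma attack_pair:
  fixes P0 P1 :: "complex Matrix.vec"
  assumes P0: "pure_state (n * m) P0" and P1: "pure_state (n * m) P1"
  shows "\<exists>Phi U0 U1 M F. pure_state (n * (m * n)) Phi \<and> unitary_mat (m * n) U0 \<and> unitary_mat (m * n) U1 \<and>
     povm_elem n M \<and> (\<forall>i<n. \<forall>j<n. cmod (M $$ (i, j)) \<le> real n) \<and>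
     1 - F \<le> meas_prob (kron M (1\<^sub>m m)) P0 - meas_prob (kron M (1\<^sub>m m)) P1 \<and>
     (\<forall>L. povm_elem (n * m) L \<longrightarrow> meas_prob L P0 = 1 \<longrightarrow>
        1 \<le> meas_prob (kron L (1\<^sub>m n)) (kron (1\<^sub>m n) U0 *\<^sub>v Phi)) \<and>
     (\<forall>L. povm_elem (n * m) L \<longrightarrow> meas_prob L P1 = 1 \<longrightarrow>
        F\<^sup>2 \<le> meas_prob (kron L (1\<^sub>m n)) (kron (1\<^sub>m n) U1 *\<^sub>v Phi))"
proof -
  obtain Z0 Z1 M where
    g0: "\<forall>i<n. \<forall>j<n. ip n (Z0 i) (Z0 j) = ip m (\<lambda>r. P0 $ (i * m + r)) (\<lambda>r. P0 $ (j * m + r))" and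
    g1: "\<forall>i<n. \<forall>j<n. ip n (Z1 i) (Z1 j) = ip m (\<lambda>r. P1 $ (i * m + r)) (\<lambda>r. P1 $ (j * m + r))" and
    hM: "hermitian n M" and
    pM: "\<forall>u. 0 \<le> Re (ip n u (mv n M u)) \<and> Re (ip n u (mv n M u)) \<le> Re (ip n u u)" and
    bM: "\<forall>i<n. \<forall>j<n. cmod (M i j) \<le> real n" and
    adv: "(\<Sum>r<m. Re (ip n (\<lambda>i. P0 $ (i * m + r)) (mv n M (\<lambda>i. P0 $ (i * m + r))))) -
       (\<Sum>r<m. Re (ip n (\<lambda>i. P1 $ (i * m + r)) (mv n M (\<lambda>i. P1 $ (i * m + r)))))
       \<ge> 1 - Re (\<Sum>i<n. ip n (Z1 i) (Z0 i))"
    using fidelity_pair[OF pure_state_norm[OF P0] pure_state_norm[OF P1]] by blast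
  \<comment> \<open>Built from \<open>Z0\<close> alone, so the commit phase is the same for both
    bits. The preceding lemma is applied with \<open>Y = Z0\<close> twice: the overlap is 1 with
    \<open>Z0\<close> and F with \<open>Z1\<close>.\<close>
  define Phi where "Phi = Matrix.vec (n * (m * n))
             (\<lambda>t. if t mod (m * n) < n then Z0 (t div (m * n)) (t mod (m * n)) else 0)"
  obtain U0 where U0: "unitary_mat (m * n) U0" and a0: "\<forall>L. povm_elem (n * m) L \<longrightarrow> meas_prob L P0 = 1 \<longrightarrow>
        (cmod (\<Sum>i<n. ip n (Z0 i) (Z0 i)))\<^sup>2 \<le> meas_prob (kron L (1\<^sub>m n)) (kron (1\<^sub>m n) U0 *\<^sub>v Phi)"
    using cheating_committer[OF P0 g0] unfolding Phi_def by blast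
  obtain U1 where U1: "unitary_mat (m * n) U1" and a1: "\<forall>L. povm_elem (n * m) L \<longrightarrow> meas_prob L P1 = 1 \<longrightarrow>
        (cmod (\<Sum>i<n. ip n (Z1 i) (Z0 i)))\<^sup>2 \<le> meas_prob (kron L (1\<^sub>m n)) (kron (1\<^sub>m n) U1 *\<^sub>v Phi)"
    using cheating_committer[OF P1 g1] unfolding Phi_def by blast
  have nZ: "(\<Sum>i<n. ip n (Z0 i) (Z0 i)) = 1"
  proof -
    have "(\<Sum>i<n. ip n (Z0 i) (Z0 i)) = (\<Sum>i<n. ip m (\<lambda>r. P0 $ (i * m + r)) (\<lambda>r. P0 $ (i * m + r)))"
      using g0 by (intro sum.cong refl) auto
    also have "\<dots> = of_real (\<Sum>i<n. \<Sum>r<m. (cmod (P0 $ (i * m + r)))\<^sup>2)"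
      unfolding ip_self of_real_sum[symmetric] ..
    finally show ?thesis unfolding pure_state_norm[OF P0] by simp
  qed
  have "n * m \<noteq> 0" using pure_state_norm[OF P0] by (intro notI) auto
  hence m: "0 < m" and n: "0 < n" by auto
  have Phi: "pure_state (n * (m * n)) Phi"
  proof -
    have c: "Phi \<in> carrier_vec (n * (m * n))" by (simp add: Phi_def)
    have "cinner Phi Phi = (\<Sum>i<n. \<Sum>k<m*n. cnj (Phi $ (i * (m * n) + k)) * Phi $ (i * (m * n) + k))"
      unfolding cinner_ip[OF c] ip_def sum_lessThan_mult ..
    also have "\<dots> = (\<Sum>i<n. ip n (Z0 i) (Z0 i))"
    proof (intro sum.cong refl)
      fix i assume i: "i \<in> {..<n}"
      have "(\<Sum>k<m*n. cnj (Phi $ (i * (m * n) + k)) * Phi $ (i * (m * n) + k)) =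
          (\<Sum>k<m*n. if k < n then cnj (Z0 i k) * Z0 i k else 0)"
        using i by (intro sum.cong refl) (simp add: Phi_def index_lt index_div)
      also have "\<dots> = (\<Sum>k\<in>{..<n}. if k < n then cnj (Z0 i k) * Z0 i k else 0)"
        using m n by (intro sum.mono_neutral_right) (auto intro: less_le_trans)
      finally show "(\<Sum>k<m*n. cnj (Phi $ (i * (m * n) + k)) * Phi $ (i * (m * n) + k)) = ip n (Z0 i) (Z0 i)"
        by (simp add: ip_def)
    qed
    finally show ?thesis using c nZ by (simp add: pure_state_def)
  qed
  define M' where "M' = Matrix.mat n n (\<lambda>(i, j). M i j)"
  have M'c: "M' \<in> carrier_mat n n" by (simp add: M'_def)
  have mvM: "mv n (mfun M') u i = mv n M u i" if "i < n" for u i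
    unfolding mv_def M'_def using that by (intro sum.cong) auto
  have ipM: "ip n u (mv n (mfun M') u) = ip n u (mv n M u)" for u
    by (intro ip_cong) (auto simp: mvM)
  have "hermitian n (mfun M')"
    unfolding hermitian_def
  proof (intro allI impI)
    fix i j assume ij: "i < n" "j < n"
    hence "M i j = cnj (M j i)" using hM unfolding hermitian_def by blast
    thus "M' $$ (i, j) = cnj (M' $$ (j, i))" using ij by (simp add: M'_def)
  qed
  hence pM': "povm_elem n M'" unfolding povm_elem_ip[OF M'c] ipM using pM by blast
  have Pc: "P0 \<in> carrier_vec (n * m)" "P1 \<in> carrier_vec (n * m)"
    using P0 P1 by (auto simp: pure_state_def)
  have advM: "1 - Re (\<Sum>i<n. ip n (Z1 i) (Z0 i)) \<le>
      meas_prob (kron M' (1\<^sub>m m)) P0 - meas_prob (kron M' (1\<^sub>m m)) P1"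
    using adv unfolding meas_prob_kron_one[OF M'c Pc(1)] meas_prob_kron_one[OF M'c Pc(2)] ipM .
  have "(Re (\<Sum>i<n. ip n (Z1 i) (Z0 i)))\<^sup>2 \<le> (cmod (\<Sum>i<n. ip n (Z1 i) (Z0 i)))\<^sup>2"
    by (rule power2_le_iff_abs_le[THEN iffD2]) (auto intro: abs_Re_le_cmod simp del: Re_sum)
  hence a1': "\<forall>L. povm_elem (n * m) L \<longrightarrow> meas_prob L P1 = 1 \<longrightarrow>
        (Re (\<Sum>i<n. ip n (Z1 i) (Z0 i)))\<^sup>2 \<le> meas_prob (kron L (1\<^sub>m n)) (kron (1\<^sub>m n) U1 *\<^sub>v Phi)"
    using a1 order_trans by blast
  have a0': "\<forall>L. povm_elem (n * m) L \<longrightarrow> meas_prob L P0 = 1 \<longrightarrow>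
        1 \<le> meas_prob (kron L (1\<^sub>m n)) (kron (1\<^sub>m n) U0 *\<^sub>v Phi)"
    using a0 unfolding nZ by simp
  have bM': "\<forall>i<n. \<forall>j<n. cmod (M' $$ (i, j)) \<le> real n" using bM by (simp add: M'_def)
  show ?thesis
    by (intro exI conjI) (rule Phi U0 U1 pM' bM' advM a0' a1')+
qed

section \<open>Averaging over the guess and over the setup\<close>

lemma integrable_pmf_bounded:
  fixes f :: "'a \<Rightarrow> 'b::{banach, second_countable_topology}"
  assumes "\<And>x. x \<in> set_pmf q \<Longrightarrow> norm (f x) \<le> B"
  shows "integrable (measure_pmf q) f"
  using assms by (intro measure_pmf.integrable_const_bound[where B = B]) (auto intro: AE_pmfI)

text \<open>Sampling \<open>x\<close> and then measuring \<open>M x\<close> is a single measurement,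
  namely the entrywise expectation. The bound \<open>B\<close>, uniform in \<open>x\<close>, makes
  the entries integrable and lets expectation pass through the finite sums.\<close>

lemma mixture_povm:
  fixes q :: "'a pmf" and M :: "'a \<Rightarrow> complex mat"
  assumes M: "\<And>x. povm_elem n (M x)" and B: "\<And>x i j. i < n \<Longrightarrow> j < n \<Longrightarrow> cmod (M x $$ (i, j)) \<le> B"
  shows "\<exists>N. povm_elem n N \<and> (\<forall>k. \<forall>v\<in>carrier_vec (n * k). meas_prob (kron N (1\<^sub>m k)) v =
     measure_pmf.expectation q (\<lambda>x. meas_prob (kron (M x) (1\<^sub>m k)) v))"
proof -
  define N where "N = Matrix.mat n n (\<lambda>(i, j). measure_pmf.expectation q (\<lambda>x. M x $$ (i, j)))"
  have Mc: "M x \<in> carrier_mat n n" for x using M by (simp add: povm_elem_def)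
  have Nc: "N \<in> carrier_mat n n" by (simp add: N_def)
  note pM = M[unfolded povm_elem_ip[OF Mc]]
  have int: "integrable q (\<lambda>x. M x $$ (i, j))" if "i < n" "j < n" for i j
    using B that by (intro integrable_pmf_bounded) auto
  have ip_M: "ip n u (mv n (mfun (M x)) w) = (\<Sum>i<n. \<Sum>j<n. (cnj (u i) * w j) * M x $$ (i, j))" for u w x
    by (simp add: ip_def mv_def sum_distrib_left mult_ac)
  have int': "integrable q (\<lambda>x. ip n u (mv n (mfun (M x)) w))" for u w
    unfolding ip_M by (intro Bochner_Integration.integrable_sum integrable_mult_right int) auto
  have ip_N: "ip n u (mv n (mfun N) w) = measure_pmf.expectation q (\<lambda>x. ip n u (mv n (mfun (M x)) w))" for u w
  proof -
    have "ip n u (mv n (mfun N) w) = (\<Sum>i<n. \<Sum>j<n. (cnj (u i) * w j) * N $$ (i, j))"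
      by (simp add: ip_def mv_def sum_distrib_left mult_ac)
    also have "\<dots> = (\<Sum>i<n. \<Sum>j<n. measure_pmf.expectation q (\<lambda>x. (cnj (u i) * w j) * M x $$ (i, j)))"
      by (intro sum.cong refl) (simp add: N_def)
    also have "\<dots> = (\<Sum>i<n. measure_pmf.expectation q (\<lambda>x. \<Sum>j<n. (cnj (u i) * w j) * M x $$ (i, j)))"
      by (intro sum.cong refl Bochner_Integration.integral_sum[symmetric] integrable_mult_right int) auto
    also have "\<dots> = measure_pmf.expectation q (\<lambda>x. \<Sum>i<n. \<Sum>j<n. (cnj (u i) * w j) * M x $$ (i, j))"
      by (intro Bochner_Integration.integral_sum[symmetric] Bochner_Integration.integrable_sum
          integrable_mult_right int) auto
    finally show ?thesis unfolding ip_M .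
  qed
  have Re_N: "Re (ip n u (mv n (mfun N) w)) = measure_pmf.expectation q (\<lambda>x. Re (ip n u (mv n (mfun (M x)) w)))"
    and int_Re: "integrable q (\<lambda>x. Re (ip n u (mv n (mfun (M x)) w)))" for u w
    unfolding ip_N using int'[of u w] by (auto intro: integrable_Re)
  have "hermitian n (mfun N)"
    unfolding hermitian_def
  proof (intro allI impI)
    fix i j assume ij: "i < n" "j < n"
    have "M x $$ (i, j) = cnj (M x $$ (j, i))" for x
      using pM ij unfolding hermitian_def by blast
    hence "(\<lambda>x. M x $$ (i, j)) = (\<lambda>x. cnj (M x $$ (j, i)))" by (rule ext)
    thus "N $$ (i, j) = cnj (N $$ (j, i))" using ij by (simp add: N_def)
  qed
  moreover have "0 \<le> Re (ip n u (mv n (mfun N) u))" for u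
    unfolding Re_N using pM by (intro integral_nonneg_AE) auto
  moreover have "Re (ip n u (mv n (mfun N) u)) \<le> Re (ip n u u)" for u
    unfolding Re_N using pM by (intro measure_pmf.integral_le_const int_Re) auto
  ultimately have "povm_elem n N" unfolding povm_elem_ip[OF Nc] by blast
  moreover have "meas_prob (kron N (1\<^sub>m k)) v = measure_pmf.expectation q (\<lambda>x. meas_prob (kron (M x) (1\<^sub>m k)) v)"
    if v: "v \<in> carrier_vec (n * k)" for k v
    unfolding meas_prob_kron_one[OF Nc v] meas_prob_kron_one[OF Mc v] Re_N
    by (intro Bochner_Integration.integral_sum[symmetric] int_Re)
  ultimately show ?thesis by blast
qed

text \<open>\<open>\<delta>\<close> trades the linear dependence of the advantage on F against the
  squares that acceptance provides, pointwise and without taking roots. The attack itself does not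
  depend on \<open>\<delta>\<close>, which can thus be chosen at the end.\<close>

lemma attack_bound:
  fixes D :: "('x \<times> 'y) pmf" and A :: "'y \<Rightarrow> 'x pmf"
    and Psi :: "'x \<Rightarrow> bool \<Rightarrow> complex Matrix.vec" and Lam :: "'y \<Rightarrow> bool \<Rightarrow> complex mat"
  assumes Psi: "\<And>x b. pure_state (n * m) (Psi x b)"
    and Lam: "\<And>y b. povm_elem (n * m) (Lam y b)"
    and corr: "\<And>x y b. (x, y) \<in> set_pmf D \<Longrightarrow> meas_prob (Lam y b) (Psi x b) = 1"
  shows "\<exists>Phi U N. (\<forall>x. pure_state (n * (m * n)) (Phi x)) \<and> (\<forall>x b. unitary_mat (m * n) (U x b)) \<and>
     (\<forall>y. povm_elem n (N y)) \<and>
     (\<forall>\<delta>>0. 2 * measure_pmf.expectation D (\<lambda>(x, y). pmf (A y) x) - 1 - \<delta> / 2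
          - (measure_pmf.expectation D
               (\<lambda>(x, y). meas_prob (kron (Lam y False) (1\<^sub>m n)) (kron (1\<^sub>m n) (U x False) *\<^sub>v Phi x))
             + measure_pmf.expectation D
               (\<lambda>(x, y). meas_prob (kron (Lam y True) (1\<^sub>m n)) (kron (1\<^sub>m n) (U x True) *\<^sub>v Phi x)) - 1) / (2 * \<delta>)
        \<le> measure_pmf.expectation D (\<lambda>(x, y). meas_prob (kron (N y) (1\<^sub>m m)) (Psi x False))
          - measure_pmf.expectation D (\<lambda>(x, y). meas_prob (kron (N y) (1\<^sub>m m)) (Psi x True)))"
proof -
  define att where "att = (\<lambda>x Phi U0 U1 M F. pure_state (n * (m * n)) Phi \<and> unitary_mat (m * n) U0 \<and> unitary_mat (m * n) U1 \<and>
     povm_elem n M \<and> (\<forall>i<n. \<forall>j<n. cmod (M $$ (i, j)) \<le> real n) \<and>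
     1 - F \<le> meas_prob (kron M (1\<^sub>m m)) (Psi x False) - meas_prob (kron M (1\<^sub>m m)) (Psi x True) \<and>
     (\<forall>L. povm_elem (n * m) L \<longrightarrow> meas_prob L (Psi x False) = 1 \<longrightarrow>
        1 \<le> meas_prob (kron L (1\<^sub>m n)) (kron (1\<^sub>m n) U0 *\<^sub>v Phi)) \<and>
     (\<forall>L. povm_elem (n * m) L \<longrightarrow> meas_prob L (Psi x True) = 1 \<longrightarrow>
        F\<^sup>2 \<le> meas_prob (kron L (1\<^sub>m n)) (kron (1\<^sub>m n) U1 *\<^sub>v Phi)))"
  have "\<forall>x. \<exists>Phi U0 U1 M F. att x Phi U0 U1 M F"
    unfolding att_def by (intro allI attack_pair Psi)
  then obtain Phi U0 U1 M F where "\<forall>x. att x (Phi x) (U0 x) (U1 x) (M x) (F x)"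
    by metis
  note att = this[rule_format, unfolded att_def]
  have Phi: "pure_state (n * (m * n)) (Phi x)"
    and U0: "unitary_mat (m * n) (U0 x)" and U1: "unitary_mat (m * n) (U1 x)"
    and M: "povm_elem n (M x)" and Mb: "i < n \<Longrightarrow> j < n \<Longrightarrow> cmod (M x $$ (i, j)) \<le> real n"
    and adv: "1 - F x \<le> meas_prob (kron (M x) (1\<^sub>m m)) (Psi x False) - meas_prob (kron (M x) (1\<^sub>m m)) (Psi x True)"
    for x i j
    using att[of x] by blast+
  have acc0: "1 \<le> meas_prob (kron (Lam y False) (1\<^sub>m n)) (kron (1\<^sub>m n) (U0 x) *\<^sub>v Phi x)"
    and acc1: "(F x)\<^sup>2 \<le> meas_prob (kron (Lam y True) (1\<^sub>m n)) (kron (1\<^sub>m n) (U1 x) *\<^sub>v Phi x)"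
    if "(x, y) \<in> set_pmf D" for x y
    using att[of x] Lam corr[OF that] by blast+
  define U where "U = (\<lambda>x b. if b then U1 x else U0 x)"
  have U: "unitary_mat (m * n) (U x b)" for x b using U0 U1 by (simp add: U_def)
  define g where "g = (\<lambda>b (x, y). meas_prob (kron (Lam y b) (1\<^sub>m n)) (kron (1\<^sub>m n) (U x b) *\<^sub>v Phi x))"
  have g: "0 \<le> g b z" "g b z \<le> 1" for b z
  proof -
    obtain x y where z: "z = (x, y)" by (cases z)
    have c: "Phi x \<in> carrier_vec (n * (m * n))" "U x b \<in> carrier_mat (m * n) (m * n)"
      using Phi[of x] U[of x b] by (auto simp: pure_state_def unitary_mat_def)
    have "kron (1\<^sub>m n) (U x b) *\<^sub>v Phi x \<in> carrier_vec (n * (m * n))"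
      by (rule mult_mat_vec_carrier[OF kron_one_left_carrier[OF c(2)] c(1)])
    hence v: "kron (1\<^sub>m n) (U x b) *\<^sub>v Phi x \<in> carrier_vec (n * m * n)"
      by (simp only: mult.assoc)
    show "0 \<le> g b z"
      unfolding g_def z prod.case by (rule meas_prob_kron_one_bounds(1)[OF Lam v])
    have "cinner (kron (1\<^sub>m n) (U x b) *\<^sub>v Phi x) (kron (1\<^sub>m n) (U x b) *\<^sub>v Phi x) = 1"
      using cinner_kron_unitary[OF U c(1)] Phi[of x] by (simp add: pure_state_def)
    thus "g b z \<le> 1"
      using meas_prob_kron_one_bounds(2)[OF Lam v, of y b] unfolding g_def z prod.case by simp
  qed
  have ig: "integrable D (g b)" for b
    using g by (intro integrable_pmf_bounded[where B = 1]) auto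
  have "\<forall>y. \<exists>N. povm_elem n N \<and> (\<forall>k. \<forall>v\<in>carrier_vec (n * k). meas_prob (kron N (1\<^sub>m k)) v =
     measure_pmf.expectation (A y) (\<lambda>x. meas_prob (kron (M x) (1\<^sub>m k)) v))"
    by (intro allI mixture_povm[OF M Mb])
  then obtain N where N: "\<forall>y. povm_elem n (N y) \<and> (\<forall>k. \<forall>v\<in>carrier_vec (n * k). meas_prob (kron (N y) (1\<^sub>m k)) v =
     measure_pmf.expectation (A y) (\<lambda>x. meas_prob (kron (M x) (1\<^sub>m k)) v))"
    by (rule choice[THEN exE])
  hence NP: "\<And>y. povm_elem n (N y)" by blast
  have Pc: "Psi x b \<in> carrier_vec (n * m)" for x b using Psi by (simp add: pure_state_def)
  have nP: "Re (cinner (Psi x b) (Psi x b)) = 1" for x b using Psi by (simp add: pure_state_def)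
  define h where "h = (\<lambda>b (x, y). meas_prob (kron (N y) (1\<^sub>m m)) (Psi x b))"
  have h: "0 \<le> h b z" "h b z \<le> 1" for b z
    using meas_prob_kron_one_bounds[OF NP Pc] by (auto simp: h_def nP split: prod.split)
  have ih: "integrable D (h b)" for b
    using h by (intro integrable_pmf_bounded[where B = 1]) auto
  define t where "t = (\<lambda>(x, y). pmf (A y) x)"
  have t: "0 \<le> t z" "t z \<le> 1" for z by (auto simp: t_def pmf_le_1 split: prod.split)
  have it: "integrable D t"
    using t by (intro integrable_pmf_bounded[where B = 1]) auto
  have pt: "2 * t z - 1 - \<delta> / 2 - g True z / (2 * \<delta>) \<le> h False z - h True z"
    if z: "z \<in> set_pmf D" and d: "\<delta> > 0" for z and \<delta> :: real
  proof -
    obtain x y where xy: "z = (x, y)" by (cases z)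
    define e where "e = (\<lambda>b x'. meas_prob (kron (M x') (1\<^sub>m m)) (Psi x b))"
    have e: "0 \<le> e b x'" "e b x' \<le> 1" for b x'
      using meas_prob_kron_one_bounds[OF M Pc] by (auto simp: e_def nP)
    have ie: "integrable (A y) (e b)" for b
      using e by (intro integrable_pmf_bounded[where B = 1]) auto
    have he: "h b z = measure_pmf.expectation (A y) (e b)" for b
      using N Pc by (simp add: h_def xy e_def)
    define G where "G = \<delta> / 2 + g True z / (2 * \<delta>)"
    have "(F x)\<^sup>2 \<le> g True z" using acc1 z by (simp add: g_def xy U_def)
    moreover have "2 * \<delta> * F x \<le> \<delta>\<^sup>2 + (F x)\<^sup>2" by (rule sum_squares_bound)
    ultimately have "2 * \<delta> * F x \<le> \<delta>\<^sup>2 + g True z" by simp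
    hence FG: "F x \<le> G" using d by (simp add: G_def field_simps power2_eq_square)
    have G: "0 \<le> G" using d g by (simp add: G_def)
    have ii: "integrable (A y) (indicator {x} :: _ \<Rightarrow> real)"
      by (intro integrable_pmf_bounded[where B = 1]) (auto simp: indicator_def)
    \<comment> \<open>The integrand is \<open>1 - F x\<close> for the right guess and -1, the worst
      possible difference of two probabilities, for a wrong one.\<close>
    have "(2 - F x) * t z - 1 = measure_pmf.expectation (A y) (\<lambda>x'. (2 - F x) * indicator {x} x' - 1)"
      using ii by (simp add: t_def xy pmf.rep_eq)
    also have "\<dots> \<le> measure_pmf.expectation (A y) (\<lambda>x'. e False x' - e True x')"
    proof (intro integral_mono_AE AE_pmfI)
      show "integrable (A y) (\<lambda>x'. (2 - F x) * indicator {x} x' - 1)"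
        by (intro integrable_pmf_bounded[where B = "\<bar>2 - F x\<bar> + 1"]) (auto simp: indicator_def)
      show "integrable (A y) (\<lambda>x'. e False x' - e True x')" by (intro Bochner_Integration.integrable_diff ie)
      fix x'
      show "(2 - F x) * indicator {x} x' - 1 \<le> e False x' - e True x'"
        using adv[of x] e(1)[of False x'] e(2)[of True x'] by (cases "x' = x") (auto simp: e_def)
    qed
    also have "\<dots> = h False z - h True z" by (simp add: he ie)
    finally have "(2 - F x) * t z - 1 \<le> h False z - h True z" .
    moreover have "F x * t z \<le> G * t z" using FG t by (intro mult_right_mono) auto
    moreover have "G * t z \<le> G * 1" using G t by (intro mult_left_mono) auto
    ultimately show ?thesis by (simp add: G_def algebra_simps)
  qed
  have "2 * measure_pmf.expectation D t - 1 - \<delta> / 2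
      - (measure_pmf.expectation D (g False) + measure_pmf.expectation D (g True) - 1) / (2 * \<delta>)
      \<le> measure_pmf.expectation D (h False) - measure_pmf.expectation D (h True)" if d: "\<delta> > 0" for \<delta>
  proof -
    \<comment> \<open>Bit 0 is opened with certainty, so the sum of both acceptance probabilities
      minus 1 bounds the one for bit 1, and with it the average of F^2.\<close>
    have "1 \<le> measure_pmf.expectation D (g False)"
      using acc0 by (intro measure_pmf.integral_ge_const ig AE_pmfI) (auto simp: g_def U_def split: prod.split)
    hence "measure_pmf.expectation D (g True) / (2 * \<delta>)
        \<le> (measure_pmf.expectation D (g False) + measure_pmf.expectation D (g True) - 1) / (2 * \<delta>)"
      using d by (intro divide_right_mono) auto
    moreover have "2 * measure_pmf.expectation D t - 1 - \<delta> / 2 - measure_pmf.expectation D (g True) / (2 * \<delta>)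
        = measure_pmf.expectation D (\<lambda>z. 2 * t z - 1 - \<delta> / 2 - g True z / (2 * \<delta>))"
      using it ig by simp
    moreover have "\<dots> \<le> measure_pmf.expectation D (\<lambda>z. h False z - h True z)"
      using it ig ih pt[OF _ d] by (intro integral_mono_AE AE_pmfI) auto
    moreover have "\<dots> = measure_pmf.expectation D (h False) - measure_pmf.expectation D (h True)"
      using ih by simp
    ultimately show ?thesis by linarith
  qed
  thus ?thesis
    using Phi U NP unfolding g_def h_def t_def
    by (intro exI[of _ Phi] exI[of _ U] exI[of _ N]) auto
qed

section \<open>Asymptotics and conclusion\<close>

lemma poly_less_power:
  fixes p :: "real poly"
  shows "\<exists>c N. \<forall>l\<ge>N. poly p (real l) < real l ^ c"
proof -
  have "\<exists>c N. \<forall>l\<ge>N. \<bar>poly p (real l)\<bar> < real l ^ c"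
  proof (induction p)
    case 0
    show ?case by (rule exI[of _ 0]) simp
  next
    case (pCons a p)
    then obtain c N where cN: "\<And>l. l \<ge> N \<Longrightarrow> \<bar>poly p (real l)\<bar> < real l ^ c" by blast
    obtain K :: nat where K: "\<bar>a\<bar> < real K" using reals_Archimedean2 by blast
    \<comment> \<open>The exponent rises by two: one factor \<open>l\<close> comes from the
      multiplication in \<open>pCons\<close>, the other absorbs the 2 that arises from bounding both
      summands alike.\<close>
    have "\<bar>poly (pCons a p) (real l)\<bar> < real l ^ (c + 2)" if l: "l \<ge> Max {N, K, 2}" for l
    proof -
      have l': "l \<ge> N" "real l \<ge> real K" "real l \<ge> 2" using l by auto
      have pow: "1 \<le> real l ^ c" using l' by simp
      have "\<bar>poly (pCons a p) (real l)\<bar> \<le> \<bar>a\<bar> + real l * \<bar>poly p (real l)\<bar>"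
        by (simp add: abs_mult order_trans[OF abs_triangle_ineq])
      also have "\<dots> < real l * real l ^ c + real l * real l ^ c"
      proof (rule add_less_le_mono)
        have "\<bar>a\<bar> < real l * 1" using K l' by simp
        also have "\<dots> \<le> real l * real l ^ c" using pow l' by (intro mult_left_mono) auto
        finally show "\<bar>a\<bar> < real l * real l ^ c" .
        show "real l * \<bar>poly p (real l)\<bar> \<le> real l * real l ^ c"
          using cN[OF l'(1)] by (intro mult_left_mono) auto
      qed
      also have "\<dots> = 2 * (real l * real l ^ c)" by simp
      also have "\<dots> \<le> real l * (real l * real l ^ c)" using l' by (intro mult_right_mono) auto
      finally show ?thesis by (simp add: mult.assoc)
    qed
    thus ?case by blast
  qed
  thus ?thesis by (metis abs_ge_self order_le_less_trans)
qed

text \<open>Take a power \<open>q\<close> of \<open>l\<close> that exceeds \<open>p\<close>. With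
  \<open>h\<close> at most \<open>1/q\<close> and \<open>\<nu>\<close> at most \<open>1/q^2\<close>,
  the assumed inequality yields \<open>3/(2p) <= 1/q + 1/(2q) = 3/(2q)\<close>, against
  \<open>p < q\<close>. The exponent for \<open>\<nu>\<close> is doubled because
  \<open>\<nu>\<close> is multiplied by \<open>p\<close>.\<close>

lemma negl_poly_contradiction:
  fixes p :: "real poly"
  assumes h: "negl h" and \<nu>: "negl \<nu>" and p: "\<forall>l. 0 < poly p (real l)"
    and le: "\<And>l. 3 / (2 * poly p (real l)) - poly p (real l) * \<nu> l / 2 \<le> h l"
  shows False
proof -
  obtain c N where cN: "\<forall>l\<ge>N. poly p (real l) < real l ^ c" using poly_less_power by blast
  obtain N1 where N1: "\<forall>l\<ge>N1. \<bar>h l\<bar> \<le> 1 / real l ^ c" using h unfolding negl_def by blast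
  obtain N2 where N2: "\<forall>l\<ge>N2. \<bar>\<nu> l\<bar> \<le> 1 / real l ^ (c + c)" using \<nu> unfolding negl_def by blast
  define l where "l = Max {N, N1, N2, 1}"
  define r where "r = poly p (real l)"
  define q where "q = real l ^ c"
  have l: "l \<ge> N" "l \<ge> N1" "l \<ge> N2" "l \<ge> 1" by (auto simp: l_def)
  have r: "0 < r" "r < q" using p cN l by (auto simp: r_def q_def)
  have hl: "h l \<le> 1 / q" and nl: "\<nu> l \<le> 1 / (q * q)"
    using N1 N2 l by (auto simp: q_def power_add abs_le_iff)
  have "r * \<nu> l \<le> r * (1 / (q * q))" using nl r by (intro mult_left_mono) auto
  also have "\<dots> \<le> 1 / q" using r by (simp add: field_simps)
  finally have "3 / (2 * r) \<le> 3 / (2 * q)" using le[of l] hl by (simp add: r_def[symmetric])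
  thus False using r by (simp add: field_simps)
qed

theorem theoremA4:
  fixes D :: "nat \<Rightarrow> (bool list \<times> bool list) pmf"
    and A :: "nat \<Rightarrow> bool list \<Rightarrow> bool list pmf"
    and p :: "real poly"
  assumes p_pos: "\<forall>l. 0 < poly p (real l)"
    and A_guess: "\<forall>l. measure_pmf.expectation (D l) (\<lambda>(x, y). pmf (A l y) x)
                        \<ge> 1/2 + 1 / poly p (real l)"
  shows "\<not> (\<exists>dC dR Psi Lam. commitment_scheme D dC dR Psi Lam \<and>
              stat_hiding D dC dR Psi \<and> stat_sum_binding D dC dR Lam)"
proof
  assume "\<exists>dC dR Psi Lam. commitment_scheme D dC dR Psi Lam \<and>
              stat_hiding D dC dR Psi \<and> stat_sum_binding D dC dR Lam"
  then obtain dC dR Psi Lam where sch: "commitment_scheme D dC dR Psi Lam"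
    and hid: "stat_hiding D dC dR Psi" and bind: "stat_sum_binding D dC dR Lam" by blast
  define good where "good = (\<lambda>l Phi U N. (\<forall>x. pure_state (dC l * (dR l * dC l)) (Phi x)) \<and>
     (\<forall>x b. unitary_mat (dR l * dC l) (U x b)) \<and> (\<forall>y. povm_elem (dC l) (N y)) \<and>
     (\<forall>\<delta>>0. 2 * measure_pmf.expectation (D l) (\<lambda>(x, y). pmf (A l y) x) - 1 - \<delta> / 2
          - (measure_pmf.expectation (D l)
               (\<lambda>(x, y). meas_prob (kron (Lam l y False) (1\<^sub>m (dC l))) (kron (1\<^sub>m (dC l)) (U x False) *\<^sub>v Phi x))
             + measure_pmf.expectation (D l)
               (\<lambda>(x, y). meas_prob (kron (Lam l y True) (1\<^sub>m (dC l))) (kron (1\<^sub>m (dC l)) (U x True) *\<^sub>v Phi x)) - 1) / (2 * \<delta>)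
        \<le> measure_pmf.expectation (D l) (\<lambda>(x, y). meas_prob (kron (N y) (1\<^sub>m (dR l))) (Psi l x False))
          - measure_pmf.expectation (D l) (\<lambda>(x, y). meas_prob (kron (N y) (1\<^sub>m (dR l))) (Psi l x True))))"
  have "\<forall>l. \<exists>Phi U N. good l Phi U N"
    unfolding good_def using sch unfolding commitment_scheme_def by (intro allI attack_bound) blast+
  then obtain Phi U N where "\<forall>l. good l (Phi l) (U l) (N l)" by metis
  note good = this[rule_format, unfolded good_def]
  define h where "h = (\<lambda>l. \<bar>measure_pmf.expectation (D l) (\<lambda>(x, y). meas_prob (kron (N l y) (1\<^sub>m (dR l))) (Psi l x False))
                 - measure_pmf.expectation (D l) (\<lambda>(x, y). meas_prob (kron (N l y) (1\<^sub>m (dR l))) (Psi l x True))\<bar>)"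
  have N: "\<forall>l y. povm_elem (dC l) (N l y)" using good by blast
  have h: "negl h" using hid N unfolding stat_hiding_def h_def by blast
  have Phi: "\<forall>l x. pure_state (dC l * (dR l * dC l)) (Phi l x)"
    and U: "\<forall>l x b. unitary_mat (dR l * dC l) (U l x b)" using good by blast+
  \<comment> \<open>The extra register E' has the dimension of C for every x.\<close>
  obtain \<nu> where \<nu>: "negl \<nu>"
    and acc: "\<forall>l. accept_prob D dC Lam (\<lambda>l x. dC l) Phi U l False
                 + accept_prob D dC Lam (\<lambda>l x. dC l) Phi U l True \<le> 1 + \<nu> l"
    using bind[unfolded stat_sum_binding_def, THEN spec, of "\<lambda>l x. dC l", THEN spec, of Phi, THEN spec, of U]
      Phi U by blast
  show False
  proof (rule negl_poly_contradiction[OF h \<nu> p_pos])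
    fix l
    define r where "r = poly p (real l)"
    have r: "0 < r" using p_pos by (simp add: r_def)
    define s where "s = accept_prob D dC Lam (\<lambda>l x. dC l) Phi U l False
                 + accept_prob D dC Lam (\<lambda>l x. dC l) Phi U l True - 1"
    have s: "s \<le> \<nu> l" using acc by (simp add: s_def algebra_simps)
    \<comment> \<open>The choice \<open>\<delta> = 1/r\<close>: from
      \<open>2 * (1/2 + 1/r) - 1 = 2/r\<close> it subtracts \<open>1/(2r)\<close>, and it scales the
      binding error by \<open>r/2\<close>.\<close>
    have "2 * measure_pmf.expectation (D l) (\<lambda>(x, y). pmf (A l y) x) - 1 - (1 / r) / 2 - s / (2 * (1 / r)) \<le>
        measure_pmf.expectation (D l) (\<lambda>(x, y). meas_prob (kron (N l y) (1\<^sub>m (dR l))) (Psi l x False))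
          - measure_pmf.expectation (D l) (\<lambda>(x, y). meas_prob (kron (N l y) (1\<^sub>m (dR l))) (Psi l x True))"
      unfolding s_def accept_prob_def
      by (rule good[THEN conjunct2, THEN conjunct2, THEN conjunct2, rule_format]) (simp add: r)
    also have "\<dots> \<le> h l" unfolding h_def by simp
    finally have adv: "2 * measure_pmf.expectation (D l) (\<lambda>(x, y). pmf (A l y) x) - 1 - (1 / r) / 2 - r * s / 2 \<le> h l"
      by (simp add: mult.commute)
    have guess: "1 / 2 + 1 / r \<le> measure_pmf.expectation (D l) (\<lambda>(x, y). pmf (A l y) x)"
      using A_guess unfolding r_def by blast
    have rs: "r * s \<le> r * \<nu> l" using s r by (intro mult_left_mono) auto
    have "3 / 2 * u - w' / 2 \<le> k" if "2 * e - 1 - u / 2 - w / 2 \<le> k" "1 / 2 + u \<le> e" "w \<le> w'"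
      for e u w w' k :: real
      using that by linarith
    from this[OF adv guess rs]
    show "3 / (2 * poly p (real l)) - poly p (real l) * \<nu> l / 2 \<le> h l"
      by (simp add: r_def)
  qed
qed

end
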